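(* Let $1\le q<\infty$, $0<\eta\le+\infty$ and $w\in V(\mathbf{R}_+)$. Then there exists a number $C=C(q,\eta,w)\ge 1$ such that for every $u\in C_c^1((0,\eta))$ $$\int_0^\eta |u'(t)|\,w(t)\,dt\ \ge\ C\left(\int_0^\eta |u(t)|^q\, V_w^q(t;\eta)\,dt\right)^{1/q}.\qquad( * )$$ Moreover, if either (i) $w\in W_0(\mathbf{R}_+)$, or (ii) $w\in W_\infty(\mathbf{R}_+)$, $\eta=\infty$ and $\lim_{t\to\infty}w(t)=0$, then the best constant $C$ in $( * )$ equals $1$.
   Context: Let $\mathbf{R}_+=(0,\infty)$. For $a\in[0,\infty]$, $W_a(\mathbf{R}_+)$ is the set of locally Lipschitz continuous functions $w:\mathbf{R}_+\to(0,\infty)$ (Lipschitz on each compact subset of $\mathbf{R}_+$) with $\lim_{t\to+0}w(t)=a$. Set $V(\mathbf{R}_+)=W_0(\mathbf{R}_+)\cup W_\infty(\mathbf{R}_+)$. For $0<\eta\le\infty$ and $w\in W_0(\mathbf{R}_+)$ define $\varphi_w(t;\eta)=\inf_{t\le s\le\eta}w(s)$ for $0<t\le\eta$ and $\varphi_w(t;\eta)=w(\eta)$ for $t\ge\eta$ (if $\eta=\infty$: $\varphi_w(t;\infty)=\inf_{s\ge t}w(s)$ for all $t>0$). For $w\in W_\infty(\mathbf{R}_+)$ define $\psi_w(t;\eta)=\inf_{0<s\le t}w(s)$ for $0<t\le\eta$ and $\psi_w(t;\eta)=\inf_{0<s\le\eta}w(s)$ for $t\ge\eta$ (if $\eta=\infty$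 only the first formula is used). These are monotone, locally Lipschitz functions on $\mathbf{R}_+$, hence differentiable almost everywhere. For $q\ge1$ define, for almost every $t\in(0,\eta)$, $V_w^q(t;\eta)=\frac{d}{dt}\big(\varphi_w(t;\eta)\big)^q$ if $w\in W_0(\mathbf{R}_+)$, and $V_w^q(t;\eta)=-\frac{d}{dt}\big(\psi_w(t;\eta)\big)^q$ if $w\in W_\infty(\mathbf{R}_+)$; thus $V_w^q\ge0$ a.e. The best constant in $( * )$ is the supremum of all $C$ for which $( * )$ holds for every $u\in C_c^1((0,\eta))$.
   Formalization: In case (i) with η=∞ it is additionally assumed that V_w^q(·;∞) is not a.e. zero; otherwise (e.g. w(t)=min(t,1/t)) the right side of ( * ) vanishes for every u and the best constant is +∞, not 1. *)

theory Defs
  imports "HOL-Analysis.Analysis"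
begin

(* Functions on (0,\<infinity>) and on (0,\<eta>) are total functions of type real \<Rightarrow> real; no definition
   below constrains or depends on their values outside the domain in question. *)

definition W_space :: "ereal \<Rightarrow> (real \<Rightarrow> real) set" where
  "W_space a = {w. (\<forall>t>0. w t > 0)
     \<and> (\<forall>K. compact K \<and> K \<subseteq> {0<..} \<longrightarrow> (\<exists>L. L-lipschitz_on K w))
     \<and> ((\<lambda>t. ereal (w t)) \<longlongrightarrow> a) (at_right 0)}"

definition V_space :: "(real \<Rightarrow> real) set" where
  "V_space = W_space 0 \<union> W_space \<infinity>"

definition open_ival :: "ereal \<Rightarrow> real set" where
  "open_ival \<eta> = {t. 0 < t \<and> ereal t < \<eta>}"

(* The sets over which the infima are taken are nonempty and w is positive there, so these
   real infima are genuine. *)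
definition \<phi> :: "(real \<Rightarrow> real) \<Rightarrow> ereal \<Rightarrow> real \<Rightarrow> real" where
  "\<phi> w \<eta> t =
     (if ereal t \<le> \<eta> then (INF s\<in>{s. t \<le> s \<and> ereal s \<le> \<eta>}. w s) else w (real_of_ereal \<eta>))"

definition \<psi> :: "(real \<Rightarrow> real) \<Rightarrow> ereal \<Rightarrow> real \<Rightarrow> real" where
  "\<psi> w \<eta> t =
     (if ereal t \<le> \<eta> then (INF s\<in>{0<..t}. w s) else (INF s\<in>{s. 0 < s \<and> ereal s \<le> \<eta>}. w s))"

(* Intended for w in V_space and t in (0,\<eta>). At the points where the function is not
   differentiable, a null set, deriv returns an unspecified value. *)
definition V_weight :: "real \<Rightarrow> (real \<Rightarrow> real) \<Rightarrow> ereal \<Rightarrow> real \<Rightarrow> real" where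
  "V_weight q w \<eta> t =
     (if w \<in> W_space 0 then deriv (\<lambda>s. \<phi> w \<eta> s powr q) t
      else - deriv (\<lambda>s. \<psi> w \<eta> s powr q) t)"

definition C1c :: "ereal \<Rightarrow> (real \<Rightarrow> real) set" where
  "C1c \<eta> = {u. u C1_differentiable_on open_ival \<eta>
     \<and> compact (closure {t \<in> open_ival \<eta>. u t \<noteq> 0})
     \<and> closure {t \<in> open_ival \<eta>. u t \<noteq> 0} \<subseteq> open_ival \<eta>}"

(* For u in C1c \<eta> and w in V_space both integrands vanish off a compact subset of (0,\<eta>) and are
   essentially bounded, so neither integral takes the default value 0 for non-integrable
   functions. *)
definition weighted_ineq :: "real \<Rightarrow> ereal \<Rightarrow> (real \<Rightarrow> real) \<Rightarrow> real \<Rightarrow> bool" where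
  "weighted_ineq q \<eta> w C \<longleftrightarrow> (\<forall>u \<in> C1c \<eta>.
     (LINT t:open_ival \<eta>|lebesgue. \<bar>deriv u t\<bar> * w t)
       \<ge> C * (LINT t:open_ival \<eta>|lebesgue. \<bar>u t\<bar> powr q * V_weight q w \<eta> t) powr (1 / q))"

(* Taken in the extended reals: the value is \<infinity> if every C is admissible. *)
definition best_constant :: "real \<Rightarrow> ereal \<Rightarrow> (real \<Rightarrow> real) \<Rightarrow> ereal" where
  "best_constant q \<eta> w = (SUP C\<in>{C. weighted_ineq q \<eta> w C}. ereal C)"

(* If w is in W_space 0, \<eta> = \<infinity> and liminf w = 0 at \<infinity> (for instance w t = min t (1/t)), then
   \<phi> w \<infinity> = 0 on (0,\<infinity>), the right-hand side of the inequality is 0 for every u, and the best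
   constant is \<infinity>. *)
definition degenerate_weight :: "real \<Rightarrow> ereal \<Rightarrow> (real \<Rightarrow> real) \<Rightarrow> bool" where
  "degenerate_weight q \<eta> w \<longleftrightarrow> (AE t in lebesgue. t \<in> open_ival \<eta> \<longrightarrow> V_weight q w \<eta> t = 0)"

end

theory Submission imports Defs begin

text \<open>
  Let \<open>p\<close> be the monotone minorant \<open>\<phi>\<close> or \<open>\<psi>\<close> of \<open>w\<close>, and let \<open>U\<close> be the variation of \<open>u\<close> between \<open>t\<close>
  and the end of the interval at which \<open>p\<close> is larger, so that \<open>\<bar>u\<bar> \<le> U\<close>. With \<open>A\<close> the corresponding
  integral of \<open>\<bar>u'\<bar> p\<close>, monotonicity gives \<open>U p \<le> A\<close>, hence the derivative of \<open>U^q p^q - A^q\<close>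
  dominates \<open>U^q V\<close> if \<open>p\<close> increases, and its negative does so if \<open>p\<close> decreases. Integrating, \<open>\<integral>\<bar>u\<bar>^q V \<le> (\<integral>\<bar>u'\<bar> p)^q \<le> (\<integral>\<bar>u'\<bar> w)^q\<close>,
  which is the inequality with \<open>C = 1\<close>. That Lipschitz functions are almost everywhere differentiable
  and are integrals of their derivatives comes from the Radon-Nikodym density of a Stieltjes measure.

  Conversely, trapezoids approximating the indicator of \<open>[a, b]\<close> turn an admissible \<open>C\<close> into
  \<open>C \<bar>p(b)^q - p(a)^q\<bar>^(1/q) \<le> w(a) + w(b)\<close>. Let the endpoint at which \<open>w\<close> vanishes tend to
  its limit, and choose the other one where \<open>w\<close> almost equals \<open>p\<close>; this forces \<open>C \<le> 1\<close>.
\<close>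

section \<open>Almost everywhere differentiability of Lipschitz functions\<close>

text \<open>The lower bound makes \<open>G\<close> a bijection with 1-Lipschitz inverse, so a
  measure giving \<open>{x..y}\<close> the mass \<open>G y - G x\<close> arises as an image of
  Lebesgue measure. The upper bound makes it absolutely continuous, and \<open>k\<close> is a real
  version of its density.\<close>

lemma Lipschitz_homeo_density:
  fixes G :: "real \<Rightarrow> real"
  assumes expand: "\<And>x y. x \<le> y \<Longrightarrow> y - x \<le> G y - G x"
    and lip: "\<And>x y. x \<le> y \<Longrightarrow> G y - G x \<le> M * (y - x)"
  obtains k where "\<And>x y. x \<le> y \<Longrightarrow> (k has_integral (G y - G x)) {x..y}"
    "\<And>x. 0 \<le> k x"
proof -
  have M: "M \<ge> 1"
    using expand[of 0 1] lip[of 0 1] by simp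
  have smono: "strict_mono G"
    by (rule strict_monoI) (smt (verit) expand)
  then have inj: "inj G" by (rule strict_mono_imp_inj_on)
  have Glip: "\<bar>G y - G x\<bar> \<le> M * \<bar>y - x\<bar>" for x y
    using lip[of x y] lip[of y x] expand[of x y] expand[of y x] by (cases "x \<le> y") auto
  have cont: "continuous_on S G" for S
  proof (rule continuous_on_subset[OF lipschitz_on_continuous_on])
    show "M-lipschitz_on UNIV G"
      using M Glip by (auto intro!: lipschitz_onI simp: dist_real_def abs_minus_commute)
  qed simp
  have surj: "surj G"
  proof (rule surjI)
    fix y
    \<comment> \<open>Expansion gives \<open>G r \<ge> G 0 + r\<close> and
      \<open>G (-r) \<le> G 0 - r\<close>, so this radius brackets \<open>y\<close>.\<close>
    define r where "r = \<bar>y - G 0\<bar> + 1"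
    have "- r \<le> 0" "0 \<le> r" "- \<bar>y - G 0\<bar> \<le> y - G 0" by (auto simp: r_def)
    then have "G (-r) \<le> y" "y \<le> G r"
      using expand[of "-r" 0] expand[of 0 r] abs_ge_self[of "y - G 0"] unfolding r_def by linarith+
    then have "\<exists>x. -r \<le> x \<and> x \<le> r \<and> G x = y"
      by (intro IVT') (auto simp: r_def cont)
    then show "G (SOME x. G x = y) = y"
      by (metis (mono_tags, lifting) someI_ex)
  qed
  define H where "H = inv G"
  have GH [simp]: "G (H y) = y" and HG [simp]: "H (G x) = x" for x y
    using inj surj by (simp_all add: H_def surj_f_inv_f)
  have Hvim: "H -` A = G ` A" for A
    by (auto simp: image_iff) (metis GH)
  have "1-lipschitz_on UNIV H"
  proof (rule lipschitz_onI)
    fix x y :: real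
    show "dist (H x) (H y) \<le> 1 * dist x y"
      using expand[of "H x" "H y"] expand[of "H y" "H x"]
      by (cases "H x \<le> H y") (auto simp: dist_real_def)
  qed simp
  then have Hmeas [measurable]: "H \<in> borel_measurable borel"
    by (intro borel_measurable_continuous_onI lipschitz_on_continuous_on)
  text \<open>The Stieltjes measure of \<open>G\<close>, obtained as a push-forward because \<open>G\<close> is invertible.\<close>
  define \<mu> where "\<mu> = distr lborel borel H"
  have sets_mu: "sets \<mu> = sets lborel" by (simp add: \<mu>_def)
  \<comment> \<open>The preimage of a null set \<open>N\<close> under \<open>H\<close> is the image
    of \<open>N\<close> under \<open>G\<close>, and Lipschitz maps send null sets to null
    sets.\<close>
  have ac: "absolutely_continuous lborel \<mu>"
    unfolding absolutely_continuous_def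
  proof
    fix N :: "real set" assume N: "N \<in> null_sets lborel"
    then have [measurable]: "N \<in> sets borel" by auto
    have "negligible N"
      using N by (simp add: negligible_iff_null_sets null_sets_completionI)
    then have "negligible (G ` N)"
    proof (rule negligible_locally_Lipschitz_image[OF order_refl])
      fix x assume "x \<in> N"
      show "\<exists>T B. open T \<and> x \<in> T \<and> (\<forall>y\<in>N \<inter> T. norm (G y - G x) \<le> B * norm (y - x))"
        using Glip by (intro exI[of _ UNIV] exI[of _ M]) auto
    qed
    then have "G ` N \<in> null_sets lebesgue" by (simp add: negligible_iff_null_sets)
    moreover have "H -` N \<in> sets borel" using measurable_sets[OF Hmeas, of N] by simp
    ultimately have "emeasure lborel (H -` N) = 0"
      unfolding Hvim[symmetric] by (simp add: null_sets_def)
    then show "N \<in> null_sets \<mu>"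
      by (auto simp: \<mu>_def emeasure_distr)
  qed
  define d where "d = RN_deriv lborel \<mu>"
  have [measurable]: "d \<in> borel_measurable borel"
    unfolding d_def using borel_measurable_RN_deriv[of lborel \<mu>] by simp
  have dens: "density lborel d = \<mu>"
    unfolding d_def using sigma_finite_measure.density_RN_deriv[OF sigma_finite_lborel ac sets_mu] .
  have em: "emeasure \<mu> {x..y} = ennreal (G y - G x)" if "x \<le> y" for x y
  proof -
    have "H -` {x..y} = {G x..G y}"
    proof (intro set_eqI)
      fix z
      have "z \<in> H -` {x..y} \<longleftrightarrow> G x \<le> G (H z) \<and> G (H z) \<le> G y"
        using smono by (simp add: strict_mono_less_eq del: GH)
      then show "z \<in> H -` {x..y} \<longleftrightarrow> z \<in> {G x..G y}" by simp
    qed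
    moreover have "G x \<le> G y" using expand[OF that] that by simp
    ultimately show ?thesis
      by (simp add: \<mu>_def emeasure_distr)
  qed
  have nn: "(\<integral>\<^sup>+t. d t * indicator {x..y} t \<partial>lborel) = ennreal (G y - G x)" if "x \<le> y" for x y
    using em[OF that] by (simp add: dens[symmetric] emeasure_density)
  \<comment> \<open>The density is extended-real valued. Its finite mass on each bounded interval
    excludes the value infinity almost everywhere, so passing to \<open>enn2real\<close> in
    \<open>k\<close> changes no integral.\<close>
  have fin: "AE t in lborel. d t \<noteq> \<infinity>"
  proof -
    have "AE t in lborel. \<forall>n::nat. d t * indicator {-real n..real n} t \<noteq> \<infinity>"
      unfolding AE_all_countable
    proof
      fix n :: nat
      show "AE t in lborel. d t * indicator {-real n..real n} t \<noteq> \<infinity>"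
        by (rule nn_integral_PInf_AE) (use nn[of "-real n" "real n"] in auto)
    qed
    then show ?thesis
    proof eventually_elim
      case (elim t)
      obtain n :: nat where "\<bar>t\<bar> \<le> real n" using real_arch_simple by blast
      then show ?case using elim[rule_format, of n] by (auto simp: indicator_def abs_le_iff split: if_splits)
    qed
  qed
  define k where "k t = enn2real (d t)" for t
  have "(k has_integral (G y - G x)) {x..y}" if "x \<le> y" for x y
  proof -
    have "(\<integral>\<^sup>+t. ennreal (k t * indicator {x..y} t) \<partial>lborel) = (\<integral>\<^sup>+t. d t * indicator {x..y} t \<partial>lborel)"
    proof (rule nn_integral_cong_AE)
      show "AE t in lborel. ennreal (k t * indicator {x..y} t) = d t * indicator {x..y} t"
        using fin by eventually_elim (auto simp: k_def indicator_def less_top)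
    qed
    then have "((\<lambda>t. k t * indicator {x..y} t) has_integral (G y - G x)) UNIV"
      using nn[OF that] expand[OF that] that
      by (intro nn_integral_has_integral) (auto simp: k_def)
    moreover have "(\<lambda>t. k t * indicator {x..y} t) = (\<lambda>t. if t \<in> {x..y} then k t else 0)"
      by (auto simp: indicator_def)
    ultimately show ?thesis by (simp only: has_integral_restrict_UNIV)
  qed
  then show thesis using that[of k] by (simp add: k_def)
qed

text \<open>Lebesgue differentiation with averages over \<open>cbox x (x + h)\<close>: the point
  \<open>x\<close> is the left endpoint, so only right difference quotients are reached.\<close>

lemma AE_right_derivative_indefinite_integral:
  fixes G k :: "real \<Rightarrow> real"
  assumes k: "\<And>x y. x \<le> y \<Longrightarrow> (k has_integral (G y - G x)) {x..y}"
  obtains N where "negligible N"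
    "\<And>x. x \<notin> N \<Longrightarrow> ((\<lambda>h. (G (x + h) - G x) / h) \<longlongrightarrow> k x) (at_right 0)"
proof -
  have "k integrable_on cbox a b" for a b
    using k[of a b] by (cases "a \<le> b") (auto simp: integrable_on_def)
  then obtain N where N: "negligible N" and
    lim: "\<And>x e. \<lbrakk>x \<notin> N; 0 < e\<rbrakk> \<Longrightarrow> \<exists>d>0. \<forall>h. 0 < h \<and> h < d \<longrightarrow>
      norm (integral (cbox x (x + h *\<^sub>R One)) k /\<^sub>R h ^ DIM(real) - k x) < e"
    using integrable_ccontinuous_explicit[of k] by metis
  have "((\<lambda>h. (G (x + h) - G x) / h) \<longlongrightarrow> k x) (at_right 0)" if "x \<notin> N" for x
    unfolding tendsto_iff
  proof (intro allI impI)
    fix e :: real assume "0 < e"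
    from lim[OF that this] obtain d where d: "d > 0"
      "\<And>h. 0 < h \<Longrightarrow> h < d \<Longrightarrow> norm (integral (cbox x (x + h *\<^sub>R One)) k /\<^sub>R h ^ DIM(real) - k x) < e"
      by blast
    show "\<forall>\<^sub>F h in at_right 0. dist ((G (x + h) - G x) / h) (k x) < e"
    proof (rule eventually_at_rightI)
      fix h assume h: "h \<in> {0<..<d}"
      have "integral {x..x + h} k = G (x + h) - G x"
        using k[of x "x + h"] h by (auto intro!: integral_unique)
      then show "dist ((G (x + h) - G x) / h) (k x) < e"
        using d(2)[of h] h by (simp add: dist_real_def divide_inverse_commute)
    qed (use d in auto)
  qed
  with N that show thesis by blast
qed

text \<open>The left quotients of \<open>G\<close> are right quotients of the reflected function
  \<open>\<lambda>x. - G (- x)\<close>, a primitive of \<open>\<lambda>x. k (- x)\<close>. Its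
  exceptional set is reflected back, which keeps it negligible.\<close>

lemma AE_derivative_indefinite_integral:
  fixes G k :: "real \<Rightarrow> real"
  assumes k: "\<And>x y. x \<le> y \<Longrightarrow> (k has_integral (G y - G x)) {x..y}"
  obtains N where "negligible N" "\<And>x. x \<notin> N \<Longrightarrow> (G has_real_derivative k x) (at x)"
proof -
  obtain N where N: "negligible N"
    "\<And>x. x \<notin> N \<Longrightarrow> ((\<lambda>h. (G (x + h) - G x) / h) \<longlongrightarrow> k x) (at_right 0)"
    using AE_right_derivative_indefinite_integral[OF k] by metis
  have "((\<lambda>x. k (- x)) has_integral (- G (- y) - - G (- x))) {x..y}" if "x \<le> y" for x y
    using has_integral_reflect_lemma_real[OF k[of "-y" "-x"]] that by simp
  then obtain N' where N': "negligible N'"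
    "\<And>x. x \<notin> N' \<Longrightarrow> ((\<lambda>h. (- G (- (x + h)) - - G (- x)) / h) \<longlongrightarrow> k (- x)) (at_right 0)"
    by (rule AE_right_derivative_indefinite_integral[of "\<lambda>x. k (- x)" "\<lambda>x. - G (- x)"]) blast+
  have "negligible (uminus ` N')"
    by (rule negligible_differentiable_image_negligible[OF order_refl N'(1)])
      (intro differentiable_on_minus differentiable_on_ident)
  moreover have "(G has_real_derivative k x) (at x)" if "x \<notin> N \<union> uminus ` N'" for x
  proof -
    have 1: "((\<lambda>h. (G (x + h) - G x) / h) \<longlongrightarrow> k x) (at_right 0)" using that N(2) by auto
    have "- x \<notin> N'" using that by (metis UnI2 image_eqI minus_minus)
    then have "((\<lambda>h. (G x - G (x - h)) / h) \<longlongrightarrow> k x) (at_right 0)" using N'(2)[of "- x"] by simp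
    moreover have "(G x - G (x - h)) / h = (G (x + - h) - G x) / - h" for h
      by (cases "h = 0") (simp_all add: field_simps)
    ultimately have 2: "((\<lambda>h. (G (x + h) - G x) / h) \<longlongrightarrow> k x) (at_left 0)"
      unfolding filterlim_at_left_to_right by simp
    show ?thesis
      using filterlim_split_at[OF 2 1] by (simp add: DERIV_def)
  qed
  ultimately show thesis using that[of "N \<union> uminus ` N'"] N(1) by auto
qed

text \<open>Rademacher's theorem in dimension one together with the fundamental theorem of calculus.
  The density of an expanding modification of \<open>f\<close> is its derivative almost everywhere,
  and subtracting the slope of the added linear term gives \<open>g\<close>.\<close>

lemma lipschitz_AE_derivative:
  fixes f :: "real \<Rightarrow> real"
  assumes lip: "L-lipschitz_on {a..b} f" and ab: "a \<le> b"
  obtains N g where "negligible N" "\<And>x. x \<in> {a<..<b} - N \<Longrightarrow> (f has_real_derivative g x) (at x)"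
    "\<And>x y. a \<le> x \<Longrightarrow> x \<le> y \<Longrightarrow> y \<le> b \<Longrightarrow> (g has_integral (f y - f x)) {x..y}"
    "g absolutely_integrable_on {a..b}"
proof -
  have L: "0 \<le> L" using lip by (rule lipschitz_on_nonneg)
  text \<open>Adding a large linear term to the clipped function makes it an expanding homeomorphism.\<close>
  define c where "c x = max a (min b x)" for x
  have c: "c x \<in> {a..b}" "\<bar>c x - c y\<bar> \<le> \<bar>x - y\<bar>" for x y using ab by (auto simp: c_def)
  define G where "G x = f (c x) + (L + 1) * x" for x
  have F: "\<bar>f (c y) - f (c x)\<bar> \<le> L * \<bar>y - x\<bar>" for x y
  proof -
    have "\<bar>f (c y) - f (c x)\<bar> \<le> L * \<bar>c y - c x\<bar>"
      using lipschitz_onD[OF lip c(1) c(1), of y x] by (simp add: dist_real_def)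
    also have "\<dots> \<le> L * \<bar>y - x\<bar>" by (rule mult_left_mono[OF c(2) L])
    finally show ?thesis .
  qed
  \<comment> \<open>The clipped function has slopes between \<open>- L\<close> and \<open>L\<close>,
    so those of \<open>G\<close> lie between 1 and \<open>2 * L + 1\<close>.\<close>
  have "y - x \<le> G y - G x" "G y - G x \<le> (2 * L + 1) * (y - x)" if "x \<le> y" for x y
    using F[of y x] that by (auto simp: G_def algebra_simps abs_if split: if_splits)
  then obtain k where k: "\<And>x y. x \<le> y \<Longrightarrow> (k has_integral (G y - G x)) {x..y}" and k0: "\<And>x. 0 \<le> k x"
    by (rule Lipschitz_homeo_density[of G "2 * L + 1"]) blast+
  obtain N where N: "negligible N" "\<And>x. x \<notin> N \<Longrightarrow> (G has_real_derivative k x) (at x)"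
    using AE_derivative_indefinite_integral[OF k] by metis
  define g where "g x = k x - (L + 1)" for x
  show thesis
  proof (rule that[of N g])
    show "negligible N" by fact
    fix x assume x: "x \<in> {a<..<b} - N"
    have "((\<lambda>x. G x - (L + 1) * x) has_real_derivative g x) (at x)"
      unfolding g_def by (rule derivative_eq_intros N(2) refl | use x in force)+
    then show "(f has_real_derivative g x) (at x)"
      by (rule has_field_derivative_transform_within_open[where S = "{a<..<b}"])
        (use x in \<open>auto simp: G_def c_def\<close>)
  next
    fix x y assume xy: "a \<le> x" "x \<le> y" "y \<le> b"
    have "(g has_integral (G y - G x - (L + 1) * (y - x))) {x..y}"
      unfolding g_def using has_integral_diff[OF k[OF xy(2)] has_integral_const_real[of "L + 1" x y]] xy
      by (simp add: mult.commute)
    moreover have "G y - G x - (L + 1) * (y - x) = f y - f x"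
      using xy by (simp add: G_def c_def algebra_simps)
    ultimately show "(g has_integral (f y - f x)) {x..y}" by simp
  next
    have "k absolutely_integrable_on {a..b}"
      using k[OF ab] k0 by (intro nonnegative_absolutely_integrable_1) (auto simp: integrable_on_def)
    then show "g absolutely_integrable_on {a..b}"
      unfolding g_def
      by (intro set_integral_diff(1) absolutely_integrable_continuous_real[of a b "\<lambda>_. L + 1"]) auto
  qed
qed

section \<open>A weighted Hardy inequality for monotone weights\<close>

text \<open>Since \<open>q - 1\<close> is nonnegative, the derivative
  \<open>q * x powr (q - 1)\<close> is largest at \<open>M\<close>. The mean value theorem evaluates
  it at an interior point, which is positive.\<close>

lemma powr_lipschitz_on:
  fixes q M :: real
  assumes "1 \<le> q" "0 \<le> M"
  shows "(q * M powr (q - 1))-lipschitz_on {0..M} (\<lambda>x. x powr q)"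
proof (rule lipschitz_onI)
  have *: "dist (x powr q) (y powr q) \<le> q * M powr (q - 1) * dist x y"
    if xy: "0 \<le> x" "x < y" "y \<le> M" for x y
  proof -
    have "continuous_on {x..y} (\<lambda>t. t powr q)"
      using xy assms by (intro continuous_on_powr' continuous_intros) auto
    then obtain l z where z: "x < z" "z < y" "((\<lambda>t. t powr q) has_real_derivative l) (at z)"
      "y powr q - x powr q = (y - x) * l"
      using MVT[OF xy(2), of "\<lambda>t. t powr q"] xy
      by (metis DERIV_isCont has_real_derivative_powr le_less_trans real_differentiable_def)
    have "((\<lambda>t. t powr q) has_real_derivative q * z powr (q - 1)) (at z)"
      using z xy by (intro has_real_derivative_powr) auto
    then have "l = q * z powr (q - 1)" using z DERIV_unique by blast
    moreover have "z powr (q - 1) \<le> M powr (q - 1)"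
      using z xy assms by (intro powr_mono2) auto
    ultimately have "0 \<le> l" "l \<le> q * M powr (q - 1)" using assms by (auto intro!: mult_left_mono)
    then show ?thesis using z(4) xy by (simp add: dist_real_def abs_minus_commute[of "x powr q"] abs_mult mult.commute[of "y - x"] mult_right_mono)
  qed
  show "dist (x powr q) (y powr q) \<le> q * M powr (q - 1) * dist x y" if "x \<in> {0..M}" "y \<in> {0..M}" for x y
    using *[of x y] *[of y x] that by (cases x y rule: linorder_cases) (auto simp: dist_commute)
qed (use assms in auto)

lemma lipschitz_on_Icc_bounded:
  fixes f :: "real \<Rightarrow> real"
  assumes "L-lipschitz_on {a..b} f"
  obtains B where "B > 0" "\<And>x. x \<in> {a..b} \<Longrightarrow> \<bar>f x\<bar> \<le> B"
proof -
  have "bounded (f ` {a..b})"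
    by (intro compact_imp_bounded compact_continuous_image lipschitz_on_continuous_on[OF assms] compact_Icc)
  then show thesis using that unfolding bounded_pos by (metis imageI real_norm_def)
qed

lemma lipschitz_on_powr:
  fixes f :: "real \<Rightarrow> real"
  assumes f: "L-lipschitz_on {a..b} f" "\<And>x. x \<in> {a..b} \<Longrightarrow> 0 \<le> f x" and q: "1 \<le> q"
  obtains K where "K-lipschitz_on {a..b} (\<lambda>x. f x powr q)"
proof -
  obtain M where M: "\<And>x. x \<in> {a..b} \<Longrightarrow> \<bar>f x\<bar> \<le> M" "M > 0"
    using lipschitz_on_Icc_bounded[OF f(1)] by blast
  have "(q * M powr (q - 1))-lipschitz_on (f ` {a..b}) (\<lambda>x. x powr q)"
    by (rule lipschitz_on_subset[OF powr_lipschitz_on]) (use M f q in fastforce)+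
  from lipschitz_on_compose2[OF f(1) this] that show thesis by blast
qed

lemma lipschitz_on_real_mult:
  fixes f g :: "real \<Rightarrow> real"
  assumes f: "L-lipschitz_on {a..b} f" and g: "M-lipschitz_on {a..b} g"
  obtains K where "K-lipschitz_on {a..b} (\<lambda>x. f x * g x)"
proof -
  obtain B where B: "\<And>x. x \<in> {a..b} \<Longrightarrow> \<bar>f x\<bar> \<le> B" "B > 0"
    using lipschitz_on_Icc_bounded[OF f] by blast
  obtain C where C: "\<And>x. x \<in> {a..b} \<Longrightarrow> \<bar>g x\<bar> \<le> C" "C > 0"
    using lipschitz_on_Icc_bounded[OF g] by blast
  have L: "0 \<le> L" "0 \<le> M" using f g lipschitz_on_nonneg by auto
  show thesis
  proof (rule that[of "B * M + C * L"], rule lipschitz_onI)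
    fix x y assume xy: "x \<in> {a..b}" "y \<in> {a..b}"
    have "\<bar>f x * g x - f y * g y\<bar> = \<bar>f x * (g x - g y) + g y * (f x - f y)\<bar>"
      by (simp add: algebra_simps)
    also have "\<dots> \<le> \<bar>f x\<bar> * \<bar>g x - g y\<bar> + \<bar>g y\<bar> * \<bar>f x - f y\<bar>"
      by (metis abs_mult abs_triangle_ineq)
    also have "\<dots> \<le> B * (M * \<bar>x - y\<bar>) + C * (L * \<bar>x - y\<bar>)"
      using lipschitz_onD[OF f xy] lipschitz_onD[OF g xy] B C xy L
      by (intro add_mono mult_mono) (auto simp: dist_real_def)
    finally show "dist (f x * g x) (f y * g y) \<le> (B * M + C * L) * dist x y"
      by (simp add: dist_real_def algebra_simps)
  qed (use B C L in auto)
qed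

section \<open>The integral estimate on a compact interval\<close>

text \<open>Redefining \<open>g\<close> as \<open>f\<close> on \<open>N\<close> leaves its integral
  unchanged and makes the comparison pointwise.\<close>

lemma integral_le_off_negligible:
  fixes f g :: "real \<Rightarrow> real"
  assumes f: "f integrable_on S" and g: "g integrable_on S" and N: "negligible N"
    and le: "\<And>t. t \<in> S - N \<Longrightarrow> f t \<le> g t"
  shows "integral S f \<le> integral S g"
proof -
  define h where "h t = (if t \<in> N then f t else g t)" for t
  have "h integrable_on S"
    by (rule integrable_spike[OF g N]) (simp add: h_def)
  then have "integral S f \<le> integral S h"
    using f le by (intro integral_le) (auto simp: h_def)
  also have "integral S h = integral S g"
    by (rule integral_spike[OF N]) (simp add: h_def)
  finally show ?thesis .
qed

text \<open>
  The sign \<open>\<sigma>\<close> is \<open>1\<close> for increasing and \<open>-1\<close> for decreasing \<open>p\<close>; it treats both directions at once.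
\<close>

lemma weighted_powr_integral_le:
  fixes p U U' A V :: "real \<Rightarrow> real" and \<sigma> q :: real
  assumes ab: "a \<le> b" and q: "1 \<le> q" and \<sigma>: "\<sigma> = 1 \<or> \<sigma> = - 1"
    and p: "Lp-lipschitz_on {a..b} p" "\<And>t. t \<in> {a..b} \<Longrightarrow> 0 \<le> p t"
    and N: "negligible N"
    and V: "\<And>t. t \<in> {a<..<b} - N \<Longrightarrow> ((\<lambda>t. p t powr q) has_real_derivative V t) (at t)"
      "\<And>t. t \<in> {a<..<b} - N \<Longrightarrow> 0 \<le> \<sigma> * V t"
    and U: "LU-lipschitz_on {a..b} U" "\<And>t. t \<in> {a..b} \<Longrightarrow> 0 \<le> U t"
      "\<And>t. t \<in> {a<..<b} \<Longrightarrow> (U has_real_derivative U' t) (at t)"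
      "\<And>t. t \<in> {a<..<b} \<Longrightarrow> \<sigma> * U' t \<le> 0"
    and A: "LA-lipschitz_on {a..b} A"
      "\<And>t. t \<in> {a<..<b} \<Longrightarrow> (A has_real_derivative U' t * p t) (at t)"
      "\<And>t. t \<in> {a..b} \<Longrightarrow> U t * p t \<le> A t"
    and ez: "(\<sigma> = 1 \<and> e = a \<and> z = b) \<or> (\<sigma> = - 1 \<and> e = b \<and> z = a)" "U z = 0" "A z = 0"
  shows "(\<lambda>t. U t powr q * (\<sigma> * V t)) absolutely_integrable_on {a..b} \<and>
    integral {a..b} (\<lambda>t. U t powr q * (\<sigma> * V t)) \<le> A e powr q"
proof -
  define f where "f t = p t powr q" for t
  obtain Lf where f: "Lf-lipschitz_on {a..b} f"
    unfolding f_def using lipschitz_on_powr[OF p q] by blast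
  have A0: "0 \<le> A t" if "t \<in> {a..b}" for t
    using A(3) p(2) U(2) that by (meson mult_nonneg_nonneg order_trans)
  obtain B where B: "\<And>x. x \<in> {a..b} \<Longrightarrow> \<bar>p x\<bar> \<le> B" "B > 0"
    using lipschitz_on_Icc_bounded[OF p(1)] by blast
  \<comment> \<open>Off a null set \<open>V\<close> coincides with the integrable density of the
    Lipschitz function \<open>f\<close>, by uniqueness of derivatives.\<close>
  have Vint: "V absolutely_integrable_on {a..b}"
  proof -
    obtain N' g where g: "negligible N'" "\<And>x. x \<in> {a<..<b} - N' \<Longrightarrow> (f has_real_derivative g x) (at x)"
      "g absolutely_integrable_on {a..b}"
      using lipschitz_AE_derivative[OF f ab] by metis
    show ?thesis
    proof (rule absolutely_integrable_spike[OF g(3)])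
      show "negligible (N \<union> N' \<union> {a, b})" using N g(1) by simp
      fix t assume "t \<in> {a..b} - (N \<union> N' \<union> {a, b})"
      then show "V t = g t" using V(1)[of t] g(2)[of t] DERIV_unique
        unfolding f_def[symmetric] by (metis DiffD1 DiffD2 DiffI Un_iff atLeastAtMost_iff greaterThanLessThan_iff insertCI less_eq_real_def)
    qed
  qed
  have cU: "continuous_on {a..b} (\<lambda>t. (U t + c) powr q)" if "0 \<le> c" for c
    using lipschitz_on_continuous_on[OF U(1)] U(2) q that
    by (intro continuous_on_powr' continuous_intros) auto
  have int: "(\<lambda>t. (U t + c) powr q * (\<sigma> * V t)) absolutely_integrable_on {a..b}" if "0 \<le> c" for c
  proof (rule absolutely_integrable_bounded_measurable_product_real)
    show "(\<lambda>t. (U t + c) powr q) \<in> borel_measurable (lebesgue_on {a..b})"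
      by (intro continuous_imp_measurable_on_sets_lebesgue cU that) auto
    show "bounded ((\<lambda>t. (U t + c) powr q) ` {a..b})"
      by (intro compact_imp_bounded compact_continuous_image cU that) auto
    show "(\<lambda>t. \<sigma> * V t) absolutely_integrable_on {a..b}"
      by (rule set_integrable_mult_right) (use Vint in auto)
  qed auto
  have I: "(\<lambda>t. U t powr q * (\<sigma> * V t)) absolutely_integrable_on {a..b}"
    using int[of 0] by simp
  text \<open>The shift by \<open>\<epsilon>\<close> keeps the bases of the powers positive, where the power is differentiable.\<close>
  have eps: "integral {a..b} (\<lambda>t. U t powr q * (\<sigma> * V t)) \<le> (A e + \<epsilon> * B) powr q" if \<epsilon>: "\<epsilon> > 0" for \<epsilon>
  proof -
    \<comment> \<open>Up to the factor \<open>- \<sigma>\<close>, the derivative of \<open>h\<close>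
      is the shifted integrand plus a nonnegative term. As \<open>B\<close> bounds \<open>p\<close>,
      adding \<open>\<epsilon> * B\<close> to \<open>A\<close> keeps it above
      \<open>(U + \<epsilon>) * p\<close>.\<close>
    define h where "h t = (A t + \<epsilon> * B) powr q - (U t + \<epsilon>) powr q * f t" for t
    obtain Lh where h: "Lh-lipschitz_on {a..b} h"
    proof -
      have "(LA + 0)-lipschitz_on {a..b} (\<lambda>t. A t + \<epsilon> * B)" "(LU + 0)-lipschitz_on {a..b} (\<lambda>t. U t + \<epsilon>)"
        by (intro lipschitz_intros A(1) U(1) lipschitz_on_constant)+
      then obtain K1 K2 where "K1-lipschitz_on {a..b} (\<lambda>t. (A t + \<epsilon> * B) powr q)"
        and K2: "K2-lipschitz_on {a..b} (\<lambda>t. (U t + \<epsilon>) powr q)"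
        using lipschitz_on_powr[OF _ _ q] A0 U(2) \<epsilon> B(2) by (metis add_nonneg_nonneg less_imp_le mult_nonneg_nonneg)
      moreover obtain K3 where "K3-lipschitz_on {a..b} (\<lambda>t. (U t + \<epsilon>) powr q * f t)"
        using lipschitz_on_real_mult[OF K2 f] by blast
      ultimately have "(K1 + K3)-lipschitz_on {a..b} h"
        unfolding h_def by (intro lipschitz_on_diff)
      then show thesis by (rule that)
    qed
    obtain N' g where g: "negligible N'" "\<And>x. x \<in> {a<..<b} - N' \<Longrightarrow> (h has_real_derivative g x) (at x)"
      "(g has_integral (h b - h a)) {a..b}"
      using lipschitz_AE_derivative[OF h ab] ab by (metis order_refl)
    have gle: "(U t + \<epsilon>) powr q * (\<sigma> * V t) \<le> - \<sigma> * g t" if t: "t \<in> {a<..<b} - (N \<union> N')" for t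
    proof -
      have t': "t \<in> {a..b}" "t \<in> {a<..<b}" "t \<in> {a<..<b} - N" "t \<in> {a<..<b} - N'" using t by auto
      have pos: "0 < A t + \<epsilon> * B" "0 < U t + \<epsilon>" using A0[OF t'(1)] U(2)[OF t'(1)] \<epsilon> B(2) by (auto intro: add_nonneg_pos)
      have "(h has_real_derivative (q * (A t + \<epsilon> * B) powr (q - 1) * (U' t * p t)
         - (q * (U t + \<epsilon>) powr (q - 1) * U' t * f t + V t * (U t + \<epsilon>) powr q))) (at t)"
        unfolding h_def
        by (rule derivative_eq_intros A(2) U(3) V(1)[folded f_def] t' pos refl | use t' pos in simp)+
      then have geq: "g t = q * (A t + \<epsilon> * B) powr (q - 1) * (U' t * p t)
         - (q * (U t + \<epsilon>) powr (q - 1) * U' t * f t + V t * (U t + \<epsilon>) powr q)"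
        using g(2)[OF t'(4)] DERIV_unique by blast
      have "- \<sigma> * g t = q * (- (\<sigma> * U' t)) * ((A t + \<epsilon> * B) powr (q - 1) * p t - (U t + \<epsilon>) powr (q - 1) * f t)
         + (U t + \<epsilon>) powr q * (\<sigma> * V t)"
        unfolding geq by (simp add: algebra_simps)
      \<comment> \<open>This is \<open>(U t + \<epsilon>) * p t \<le> A t + \<epsilon> * B\<close>
        raised to the power \<open>q - 1\<close> and multiplied by \<open>p t\<close>.\<close>
      moreover have "(U t + \<epsilon>) powr (q - 1) * f t \<le> (A t + \<epsilon> * B) powr (q - 1) * p t"
      proof (cases "p t = 0")
        case True then show ?thesis by (simp add: f_def)
      next
        case False
        then have pt: "p t > 0" using p(2)[OF t'(1)] by simp
        have "(U t + \<epsilon>) * p t \<le> A t + \<epsilon> * B"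
          using A(3)[OF t'(1)] mult_left_mono[OF abs_le_D1[OF B(1)[OF t'(1)]], of \<epsilon>] \<epsilon>
          unfolding distrib_right by linarith
        then have "((U t + \<epsilon>) * p t) powr (q - 1) \<le> (A t + \<epsilon> * B) powr (q - 1)"
          using pos pt q by (intro powr_mono2) auto
        moreover have "f t = p t powr (q - 1) * p t"
          using powr_mult_base[of "p t" "q - 1"] pt by (simp add: f_def mult.commute)
        ultimately show ?thesis
          using pt pos by (simp add: powr_mult mult.assoc[symmetric] mult_right_mono)
      qed
      then have "0 \<le> q * (- (\<sigma> * U' t)) * ((A t + \<epsilon> * B) powr (q - 1) * p t - (U t + \<epsilon>) powr (q - 1) * f t)"
        using U(4)[OF t'(2)] q by (intro mult_nonneg_nonneg) auto
      ultimately show ?thesis by linarith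
    qed
    have Neg: "negligible (N \<union> N' \<union> {a, b})" using N g(1) by simp
    have "integral {a..b} (\<lambda>t. U t powr q * (\<sigma> * V t)) \<le> integral {a..b} (\<lambda>t. - \<sigma> * g t)"
    proof (rule integral_le_off_negligible[OF _ _ Neg])
      show "(\<lambda>t. U t powr q * (\<sigma> * V t)) integrable_on {a..b}"
        using I by (rule set_lebesgue_integral_eq_integral(1))
      show "(\<lambda>t. - \<sigma> * g t) integrable_on {a..b}"
        using has_integral_mult_right[OF g(3), of "- \<sigma>"] by (auto simp: integrable_on_def)
      fix t assume t: "t \<in> {a..b} - (N \<union> N' \<union> {a, b})"
      have "U t powr q * (\<sigma> * V t) \<le> (U t + \<epsilon>) powr q * (\<sigma> * V t)"
        using U(2)[of t] V(2)[of t] t \<epsilon> q by (intro mult_right_mono powr_mono2) auto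
      also have "\<dots> \<le> - \<sigma> * g t" by (rule gle) (use t in auto)
      finally show "U t powr q * (\<sigma> * V t) \<le> - \<sigma> * g t" .
    qed
    also have "\<dots> = - \<sigma> * (h b - h a)"
      using has_integral_mult_right[OF g(3), of "- \<sigma>"] by (rule integral_unique)
    \<comment> \<open>The factor \<open>- \<sigma>\<close> orients the increment from
      \<open>z\<close> to \<open>e\<close>, whichever of them is the left endpoint.\<close>
    also have "\<dots> = h e - h z" using ez by auto
    finally have "integral {a..b} (\<lambda>t. U t powr q * (\<sigma> * V t)) \<le> h e - h z" .
    moreover have "h e \<le> (A e + \<epsilon> * B) powr q" by (simp add: h_def f_def)
    \<comment> \<open>At \<open>z\<close> both \<open>U\<close> and \<open>A\<close> vanish, leaving
      \<open>(\<epsilon> * B) powr q - \<epsilon> powr q * p z powr q\<close>, which is nonnegative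
      because \<open>B\<close> bounds \<open>p\<close>.\<close>
    moreover have "- h z \<le> 0"
    proof -
      have "z \<in> {a..b}" using ez ab by auto
      then have "p z powr q \<le> B powr q" using p(2)[of z] B(1)[of z] q by (intro powr_mono2) auto
      then show ?thesis using ez \<epsilon> B(2) by (simp add: h_def f_def powr_mult)
    qed
    ultimately show ?thesis by linarith
  qed
  \<comment> \<open>The limit base \<open>A e\<close> may be 0; the power still converges, along
    nonnegative bases and with a positive exponent.\<close>
  have "((\<lambda>\<epsilon>. (A e + \<epsilon> * B) powr q) \<longlongrightarrow> (A e + 0 * B) powr q) (at_right 0)"
  proof (rule tendsto_powr')
    show "A e + 0 * B \<noteq> 0 \<or> 0 < q \<and> (\<forall>\<^sub>F x in at_right 0. 0 \<le> A e + x * B)"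
    proof (intro disjI2 conjI)
      have "e \<in> {a..b}" using ez ab by auto
      from A0[OF this] show "\<forall>\<^sub>F x in at_right 0. 0 \<le> A e + x * B"
        using B(2) by (intro eventually_at_rightI[of 0 1]) auto
    qed (use q in auto)
  qed (intro tendsto_intros)+
  then have "integral {a..b} (\<lambda>t. U t powr q * (\<sigma> * V t)) \<le> (A e + 0 * B) powr q"
    by (rule tendsto_lowerbound) (auto intro!: eventually_at_rightI[of 0 1] eps)
  then show ?thesis using I by simp
qed

section \<open>The inequality with constant one\<close>

lemma indefinite_integral_continuous_on:
  fixes k :: "real \<Rightarrow> real"
  assumes k: "continuous_on {a..b} k"
  shows "\<exists>L. L-lipschitz_on {a..b} (\<lambda>t. integral {a..t} k)"
    "\<And>t. t \<in> {a<..<b} \<Longrightarrow> ((\<lambda>t. integral {a..t} k) has_real_derivative k t) (at t)"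
    "\<And>s t. a \<le> s \<Longrightarrow> s \<le> t \<Longrightarrow> t \<le> b \<Longrightarrow> integral {a..t} k - integral {a..s} k = integral {s..t} k"
proof -
  have D: "((\<lambda>t. integral {a..t} k) has_real_derivative k t) (at t within {a..b})" if "t \<in> {a..b}" for t
    using integral_has_real_derivative[OF k that] .
  show "((\<lambda>t. integral {a..t} k) has_real_derivative k t) (at t)" if "t \<in> {a<..<b}" for t
    using D[of t] that by (simp add: at_within_Icc_at)
  show "integral {a..t} k - integral {a..s} k = integral {s..t} k" if "a \<le> s" "s \<le> t" "t \<le> b" for s t
  proof -
    have "k integrable_on {a..t}"
      by (rule integrable_continuous_real[OF continuous_on_subset[OF k]]) (use that in auto)
    from Henstock_Kurzweil_Integration.integral_combine[OF that(1,2) this] show ?thesis by simp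
  qed
  have "bounded (k ` {a..b})"
    by (intro compact_imp_bounded compact_continuous_image k compact_Icc)
  then obtain B where B: "B > 0" "\<And>t. t \<in> {a..b} \<Longrightarrow> \<bar>k t\<bar> \<le> B"
    unfolding bounded_pos by (metis imageI real_norm_def)
  have "B-lipschitz_on {a..b} (\<lambda>t. integral {a..t} k)"
  proof (rule bounded_derivative_imp_lipschitz)
    show "((\<lambda>t. integral {a..t} k) has_derivative (*) (k t)) (at t within {a..b})" if "t \<in> {a..b}" for t
      using D[OF that] by (simp add: has_field_derivative_def)
    show "onorm ((*) (k t)) \<le> B" if "t \<in> {a..b}" for t
      by (rule onorm_bound) (use B that in \<open>auto simp: abs_mult intro!: mult_right_mono\<close>)
  qed (use B in auto)
  then show "\<exists>L. L-lipschitz_on {a..b} (\<lambda>t. integral {a..t} k)" ..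
qed

lemma open_open_ival: "open (open_ival \<eta>)"
proof -
  have "open ({0<..} \<inter> ereal -` {..<\<eta>})"
    by (intro open_Int open_greaterThan open_vimage) (auto intro: continuous_on_ereal)
  moreover have "{0<..} \<inter> ereal -` {..<\<eta>} = open_ival \<eta>" by (auto simp: open_ival_def)
  ultimately show ?thesis by simp
qed

lemma open_ival_Icc_subset: "0 < a \<Longrightarrow> b \<in> open_ival \<eta> \<Longrightarrow> {a..b} \<subseteq> open_ival \<eta>"
  by (auto simp: open_ival_def) (meson ereal_less_eq(3) le_less_trans)

lemma C1c_derivative:
  assumes "u \<in> C1c \<eta>"
  shows "\<And>t. t \<in> open_ival \<eta> \<Longrightarrow> (u has_real_derivative deriv u t) (at t)"
    "continuous_on (open_ival \<eta>) (deriv u)"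
proof -
  obtain D where D: "\<And>t. t \<in> open_ival \<eta> \<Longrightarrow> (u has_real_derivative D t) (at t)" "continuous_on (open_ival \<eta>) D"
    using assms by (auto simp: C1c_def C1_differentiable_on_def has_real_derivative_iff_has_vector_derivative)
  have eq: "deriv u t = D t" if "t \<in> open_ival \<eta>" for t using D(1)[OF that] by (rule DERIV_imp_deriv)
  show "(u has_real_derivative deriv u t) (at t)" if "t \<in> open_ival \<eta>" for t
    using D(1)[OF that] eq[OF that] by simp
  show "continuous_on (open_ival \<eta>) (deriv u)"
    using D(2) eq by (simp cong: continuous_on_cong)
qed

text \<open>A compact support leaves room on both sides, so it fits into some
  \<open>{a<..<b}\<close> whose closure stays in the domain. Off the support \<open>u\<close>
  vanishes on an open set, hence so does its derivative; in particular both vanish at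
  \<open>a\<close> and \<open>b\<close>.\<close>

lemma C1c_support:
  assumes u: "u \<in> C1c \<eta>" and \<eta>: "0 < \<eta>"
  obtains a b where "0 < a" "a < b" "b \<in> open_ival \<eta>"
    "\<And>t. t \<in> open_ival \<eta> - {a<..<b} \<Longrightarrow> u t = 0"
    "\<And>t. t \<in> open_ival \<eta> - {a<..<b} \<Longrightarrow> deriv u t = 0"
proof -
  define K where "K = closure {t \<in> open_ival \<eta>. u t \<noteq> 0}"
  have K: "compact K" "K \<subseteq> open_ival \<eta>" using u by (auto simp: C1c_def K_def)
  have zero: "u t = 0" if "t \<in> open_ival \<eta> - K" for t
    using that closure_subset[of "{t \<in> open_ival \<eta>. u t \<noteq> 0}"] by (auto simp: K_def)
  have dzero: "deriv u t = 0" if t: "t \<in> open_ival \<eta> - K" for t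
  proof -
    have "((\<lambda>_. 0) has_real_derivative deriv u t) (at t)"
    proof (rule has_field_derivative_transform_within_open)
      show "(u has_real_derivative deriv u t) (at t)" using C1c_derivative(1)[OF u] t by auto
      show "open (open_ival \<eta> - K)" using open_open_ival K(1) by (intro open_Diff compact_imp_closed)
    qed (use t zero in auto)
    then show ?thesis using DERIV_unique DERIV_const by blast
  qed
  have "\<exists>a b. 0 < a \<and> a < b \<and> b \<in> open_ival \<eta> \<and> K \<subseteq> {a<..<b}"
  proof (cases "K = {}")
    case True
    obtain r where "0 < ereal r" "ereal r < \<eta>" using ereal_dense2[OF \<eta>] by auto
    then show ?thesis using True by (intro exI[of _ "r/2"] exI[of _ r]) (auto simp: open_ival_def)
  next
    case False
    obtain m where m: "m \<in> K" "\<And>t. t \<in> K \<Longrightarrow> m \<le> t" using compact_attains_inf[OF K(1) False] by auto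
    obtain M where M: "M \<in> K" "\<And>t. t \<in> K \<Longrightarrow> t \<le> M" using compact_attains_sup[OF K(1) False] by auto
    have "0 < m" "ereal M < \<eta>" using m M K by (auto simp: open_ival_def)
    moreover obtain r where "ereal M < ereal r" "ereal r < \<eta>" using ereal_dense2[OF \<open>ereal M < \<eta>\<close>] by auto
    moreover have "m \<le> M" using m M by auto
    ultimately show ?thesis using m M
      by (intro exI[of _ "m/2"] exI[of _ r]) (force simp: open_ival_def)
  qed
  then obtain a b where ab: "0 < a" "a < b" "b \<in> open_ival \<eta>" "K \<subseteq> {a<..<b}" by blast
  then have "t \<in> open_ival \<eta> - K" if "t \<in> open_ival \<eta> - {a<..<b}" for t using that by blast
  then show thesis using that[OF ab(1-3)] zero dzero by blast
qed

section \<open>The inequality for an abstract monotone minorant\<close>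

text \<open>Common interface of \<open>\<phi> w \<eta>\<close> with \<open>\<sigma> = 1\<close> and
  \<open>\<psi> w \<eta>\<close> with \<open>\<sigma> = - 1\<close>. Multiplying by
  \<open>\<sigma>\<close> makes either minorant increasing and its weight nonnegative almost
  everywhere.\<close>

locale monotone_minorant =
  fixes w p :: "real \<Rightarrow> real" and \<eta> :: ereal and \<sigma> :: real
  assumes eta_pos: "0 < \<eta>"
    and sigma: "\<sigma> = 1 \<or> \<sigma> = - 1"
    and w_continuous: "continuous_on {0<..} w"
    and p_nonneg: "\<And>t. t \<in> open_ival \<eta> \<Longrightarrow> 0 \<le> p t"
    and p_le: "\<And>t. t \<in> open_ival \<eta> \<Longrightarrow> p t \<le> w t"
    and p_mono: "\<And>s t. s \<in> open_ival \<eta> \<Longrightarrow> t \<in> open_ival \<eta> \<Longrightarrow> s \<le> t \<Longrightarrow> \<sigma> * p s \<le> \<sigma> * p t"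
    and p_lipschitz: "\<And>a b. 0 < a \<Longrightarrow> b \<in> open_ival \<eta> \<Longrightarrow> \<exists>L. L-lipschitz_on {a..b} p"
    and V_weight_eq: "\<And>q t. t \<in> open_ival \<eta> \<Longrightarrow> V_weight q w \<eta> t = \<sigma> * deriv (\<lambda>s. p s powr q) t"
begin

text \<open>The weight contains \<open>deriv\<close>, which is unspecified where
  \<open>p powr q\<close> is not differentiable. Off a null set it is \<open>\<sigma>\<close> times
  the density of this Lipschitz function; hence its integrability and its integral, while
  monotonicity of \<open>p\<close> gives the sign.\<close>

lemma weight_integral:
  assumes q: "1 \<le> q" and ab: "0 < a" "a \<le> b" "b \<in> open_ival \<eta>"
  obtains N where "negligible N"
    "\<And>t. t \<in> {a<..<b} - N \<Longrightarrow> ((\<lambda>s. p s powr q) has_real_derivative deriv (\<lambda>s. p s powr q) t) (at t)"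
    "\<And>t. t \<in> {a<..<b} - N \<Longrightarrow> 0 \<le> V_weight q w \<eta> t"
    "V_weight q w \<eta> absolutely_integrable_on {a..b}"
    "(V_weight q w \<eta> has_integral \<sigma> * (p b powr q - p a powr q)) {a..b}"
proof -
  define f where "f t = p t powr q" for t
  have sub: "{a..b} \<subseteq> open_ival \<eta>" using ab by (intro open_ival_Icc_subset)
  obtain L where "L-lipschitz_on {a..b} p" using p_lipschitz ab by blast
  then obtain K where "K-lipschitz_on {a..b} f"
    unfolding f_def using lipschitz_on_powr[OF _ _ q] p_nonneg sub by (metis subsetD)
  then obtain N g where N: "negligible N" and
    g: "\<And>x. x \<in> {a<..<b} - N \<Longrightarrow> (f has_real_derivative g x) (at x)"
      "\<And>x y. a \<le> x \<Longrightarrow> x \<le> y \<Longrightarrow> y \<le> b \<Longrightarrow> (g has_integral (f y - f x)) {x..y}"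
      "g absolutely_integrable_on {a..b}"
    using lipschitz_AE_derivative ab(2) by (metis (no_types))
  have d: "deriv f t = g t" if "t \<in> {a<..<b} - N" for t
    using g(1)[OF that] by (rule DERIV_imp_deriv)
  have V: "V_weight q w \<eta> t = \<sigma> * g t" if "t \<in> {a<..<b} - N" for t
    using V_weight_eq[of t q] sub that d[OF that] unfolding f_def by (auto simp: subset_iff)
  have neg: "negligible (N \<union> {a, b})" using N by simp
  show thesis
  proof (rule that[OF N])
    fix t assume t: "t \<in> {a<..<b} - N"
    show "((\<lambda>s. p s powr q) has_real_derivative deriv (\<lambda>s. p s powr q) t) (at t)"
      using g(1)[OF t] d[OF t] unfolding f_def by simp
    have "0 \<le> \<sigma> * g t"
    proof (rule mono_on_imp_deriv_nonneg)
      show "mono_on {a<..<b} (\<lambda>s. \<sigma> * f s)"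
      proof (rule mono_onI)
        fix r s assume rs: "r \<in> {a<..<b}" "s \<in> {a<..<b}" "r \<le> s"
        then have rs': "r \<in> open_ival \<eta>" "s \<in> open_ival \<eta>" using sub by auto
        show "\<sigma> * f r \<le> \<sigma> * f s"
          using p_mono[OF rs' rs(3)] p_nonneg[OF rs'(1)] p_nonneg[OF rs'(2)] sigma q
          by (auto simp: f_def intro!: powr_mono2)
      qed
      show "((\<lambda>s. \<sigma> * f s) has_real_derivative \<sigma> * g t) (at t)"
        by (rule DERIV_cmult[OF g(1)[OF t]])
    qed (use t in auto)
    then show "0 \<le> V_weight q w \<eta> t" using V[OF t] by simp
  next
    have "(\<lambda>t. \<sigma> * g t) absolutely_integrable_on {a..b}"
      by (rule set_integrable_mult_right) (use g(3) in auto)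
    then show "V_weight q w \<eta> absolutely_integrable_on {a..b}"
      by (rule absolutely_integrable_spike[OF _ neg]) (use V in auto)
    show "(V_weight q w \<eta> has_integral \<sigma> * (p b powr q - p a powr q)) {a..b}"
      by (rule has_integral_spike[OF neg _ has_integral_mult_right[OF g(2)[of a b, unfolded f_def]]])
        (use V ab in auto)
  qed
qed

text \<open>On a compact \<open>{a..b}\<close> around the support the integral estimate applies:
  \<open>U\<close> integrates \<open>v\<close>, the modulus of \<open>deriv u\<close>, and
  \<open>A\<close> integrates \<open>v * p\<close>, both between \<open>t\<close> and
  \<open>z\<close>. Then \<open>U\<close> is replaced by the modulus of \<open>u\<close> on one side
  and \<open>p\<close> by \<open>w\<close> on the other.\<close>

lemma weighted_ineq_1:
  assumes q: "1 \<le> q"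
  shows "weighted_ineq q \<eta> w 1"
  unfolding weighted_ineq_def
proof
  fix u assume u: "u \<in> C1c \<eta>"
  obtain a b where ab: "0 < a" "a < b" "b \<in> open_ival \<eta>"
    and u0: "\<And>t. t \<in> open_ival \<eta> - {a<..<b} \<Longrightarrow> u t = 0"
    and du0: "\<And>t. t \<in> open_ival \<eta> - {a<..<b} \<Longrightarrow> deriv u t = 0"
    using C1c_support[OF u eta_pos] by metis
  have sub: "{a..b} \<subseteq> open_ival \<eta>" using ab by (intro open_ival_Icc_subset) auto
  define v where "v t = \<bar>deriv u t\<bar>" for t
  have cd: "continuous_on {a..b} (deriv u)" using C1c_derivative(2)[OF u] sub continuous_on_subset by blast
  then have cv: "continuous_on {a..b} v" unfolding v_def by (intro continuous_intros)
  obtain Lp where Lp: "Lp-lipschitz_on {a..b} p" using p_lipschitz ab by blast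
  have cp: "continuous_on {a..b} p" using Lp by (rule lipschitz_on_continuous_on)
  have cw: "continuous_on {a..b} w" by (rule continuous_on_subset[OF w_continuous]) (use ab in auto)
  have cvp: "continuous_on {a..b} (\<lambda>t. v t * p t)" using cv cp by (intro continuous_intros)
  define J where "J t = integral {a..t} v" for t
  define B where "B t = integral {a..t} (\<lambda>t. v t * p t)" for t
  \<comment> \<open>At \<open>z\<close> the minorant is largest and both \<open>U\<close> and
    \<open>A\<close> vanish; at the opposite endpoint \<open>e\<close> the function \<open>A\<close>
    is the full integral of \<open>v * p\<close>.\<close>
  define z where "z = (if \<sigma> = 1 then b else a)"
  define e where "e = (if \<sigma> = 1 then a else b)"
  define U where "U t = - \<sigma> * (J t - J z)" for t
  define A where "A t = - \<sigma> * (B t - B z)" for t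
  note J = indefinite_integral_continuous_on[OF cv, folded J_def]
  note B = indefinite_integral_continuous_on[OF cvp, folded B_def]
  have z: "z \<in> {a..b}" using ab by (auto simp: z_def)
  have Ueq: "U t = integral (if \<sigma> = 1 then {t..b} else {a..t}) v" 
    and Aeq: "A t = integral (if \<sigma> = 1 then {t..b} else {a..t}) (\<lambda>t. v t * p t)" if "t \<in> {a..b}" for t
    using J(3)[of t b] J(3)[of a t] B(3)[of t b] B(3)[of a t] that sigma by (auto simp: U_def A_def z_def)
  have int: "v integrable_on {r..s}" "(\<lambda>t. v t * p t) integrable_on {r..s}" "deriv u integrable_on {r..s}" if "a \<le> r" "s \<le> b" for r s
    by (intro integrable_continuous_real continuous_on_subset[OF cv] continuous_on_subset[OF cvp] continuous_on_subset[OF cd]; use that in auto)+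
  have U0: "0 \<le> U t" if t: "t \<in> {a..b}" for t
    unfolding Ueq[OF t] using t int by (intro integral_nonneg) (auto simp: v_def)
  \<comment> \<open>As \<open>u\<close> vanishes at both endpoints, \<open>u t\<close> is up to sign
    the integral of \<open>deriv u\<close> between \<open>t\<close> and \<open>z\<close>.\<close>
  have uU: "\<bar>u t\<bar> \<le> U t" if t: "t \<in> {a..b}" for t
  proof -
    have *: "\<bar>u s - u r\<bar> \<le> integral {r..s} v" if "a \<le> r" "r \<le> s" "s \<le> b" for r s
    proof -
      have "(deriv u has_integral (u s - u r)) {r..s}"
      proof (rule fundamental_theorem_of_calculus[OF that(2)])
        fix x assume "x \<in> {r..s}"
        then have "(u has_real_derivative deriv u x) (at x)"
          using C1c_derivative(1)[OF u] sub that by (auto simp: subset_iff)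
        then show "(u has_vector_derivative deriv u x) (at x within {r..s})"
          by (simp add: has_real_derivative_iff_has_vector_derivative has_vector_derivative_at_within)
      qed
      moreover have "norm (integral {r..s} (deriv u)) \<le> integral {r..s} v"
        using that by (intro integral_norm_bound_integral int) (auto simp: v_def)
      ultimately show ?thesis by (simp add: integral_unique)
    qed
    have "u a = 0" "u b = 0" using u0 sub ab by (auto simp: subset_iff)
    then show ?thesis unfolding Ueq[OF t] using *[of t b] *[of a t] t by auto
  qed
  obtain N where N: "negligible N"
    "\<And>t. t \<in> {a<..<b} - N \<Longrightarrow> ((\<lambda>s. p s powr q) has_real_derivative deriv (\<lambda>s. p s powr q) t) (at t)"
    "\<And>t. t \<in> {a<..<b} - N \<Longrightarrow> 0 \<le> V_weight q w \<eta> t"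
    by (rule weight_integral[OF q ab(1) less_imp_le[OF ab(2)] ab(3)]) blast
  have p0: "0 \<le> p t" if "t \<in> {a..b}" for t using p_nonneg sub that by auto
  \<comment> \<open>Between \<open>t\<close> and \<open>z\<close> the function \<open>p\<close> is
    at least \<open>p t\<close>.\<close>
  have UpA: "U t * p t \<le> A t" if t: "t \<in> {a..b}" for t
  proof -
    define S where "S = (if \<sigma> = 1 then {t..b} else {a..t})"
    have "U t * p t = integral S (\<lambda>s. v s * p t)"
      unfolding Ueq[OF t] S_def by simp
    also have "\<dots> \<le> integral S (\<lambda>t. v t * p t)"
    proof (rule integral_le)
      show "(\<lambda>s. v s * p t) integrable_on S" "(\<lambda>t. v t * p t) integrable_on S"
        unfolding S_def using int t by (auto intro!: integrable_on_mult_left)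
      fix s assume s: "s \<in> S"
      then have "s \<in> {a..b}" using t by (auto simp: S_def split: if_splits)
      then have "p t \<le> p s"
        using p_mono[of t s] p_mono[of s t] s t sub sigma by (auto simp: S_def subset_iff split: if_splits)
      then show "v s * p t \<le> v s * p s" by (intro mult_left_mono) (auto simp: v_def)
    qed
    finally show ?thesis unfolding Aeq[OF t] S_def .
  qed
  obtain LU where LU: "LU-lipschitz_on {a..b} U"
  proof -
    from J(1) obtain L where "L-lipschitz_on {a..b} J" by blast
    then have "(\<bar>- \<sigma>\<bar> * (L + 0))-lipschitz_on {a..b} U"
      unfolding U_def by (intro lipschitz_on_cmult_real lipschitz_on_diff lipschitz_on_constant)
    then show thesis by (rule that)
  qed
  obtain LA where LA: "LA-lipschitz_on {a..b} A"
  proof -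
    from B(1) obtain L where "L-lipschitz_on {a..b} B" by blast
    then have "(\<bar>- \<sigma>\<bar> * (L + 0))-lipschitz_on {a..b} A"
      unfolding A_def by (intro lipschitz_on_cmult_real lipschitz_on_diff lipschitz_on_constant)
    then show thesis by (rule that)
  qed
  have UV: "(\<lambda>t. U t powr q * (\<sigma> * deriv (\<lambda>s. p s powr q) t)) absolutely_integrable_on {a..b} \<and>
    integral {a..b} (\<lambda>t. U t powr q * (\<sigma> * deriv (\<lambda>s. p s powr q) t)) \<le> A e powr q"
  proof (rule weighted_powr_integral_le[where N = N and U' = "\<lambda>t. - \<sigma> * v t" and z = z and e = e])
    show "(U has_real_derivative - \<sigma> * v t) (at t)" if "t \<in> {a<..<b}" for t
      unfolding U_def by (rule derivative_eq_intros J(2)[OF that] refl | simp)+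
    show "(A has_real_derivative - \<sigma> * v t * p t) (at t)" if "t \<in> {a<..<b}" for t
      unfolding A_def by (rule derivative_eq_intros B(2)[OF that] refl | simp)+
    show "\<sigma> * (- \<sigma> * v t) \<le> 0" for t using sigma by (auto simp: v_def)
    show "0 \<le> \<sigma> * deriv (\<lambda>s. p s powr q) t" if "t \<in> {a<..<b} - N" for t
      using N(3)[OF that] V_weight_eq[of t q] sub that by (auto simp: subset_iff)
    show "(\<sigma> = 1 \<and> e = a \<and> z = b) \<or> (\<sigma> = - 1 \<and> e = b \<and> z = a)" 
      using sigma by (auto simp: e_def z_def)
  qed (use ab q sigma Lp p0 N LU U0 LA UpA in \<open>auto simp: U_def A_def\<close>)
  have Vab: "U t powr q * V_weight q w \<eta> t = U t powr q * (\<sigma> * deriv (\<lambda>s. p s powr q) t)" if "t \<in> {a..b}" for t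
    using V_weight_eq[of t q] sub that by auto
  have UVi: "set_integrable lebesgue {a..b} (\<lambda>t. U t powr q * V_weight q w \<eta> t)"
    by (subst set_integrable_cong[OF refl refl Vab]) (use UV in auto)
  have UVl: "(LINT t:{a..b}|lebesgue. U t powr q * V_weight q w \<eta> t) \<le> A e powr q"
    using set_lebesgue_integral_eq_integral(2)[OF UVi] UV integral_cong[OF Vab, of "{a..b}"] by simp
  \<comment> \<open>The sign of the weight is known on the open interval off \<open>N\<close>, so
    both endpoints join the exceptional set.\<close>
  have Nae: "AE t in lebesgue. t \<notin> N \<union> {a, b}"
    by (rule AE_not_in) (use N(1) in \<open>simp add: negligible_iff_null_sets[symmetric]\<close>)
  have Vout: "indicat_real (open_ival \<eta>) t *\<^sub>R (\<bar>u t\<bar> powr q * V_weight q w \<eta> t) = 0" if "t \<notin> {a<..<b}" for t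
    using u0[of t] that by (auto simp: indicator_def)
  \<comment> \<open>The comparison rests on an integrable, nonnegative majorant: if the left
    integrand were not integrable, its integral would be 0 and the bound would persist.\<close>
  have X: "(LINT t:open_ival \<eta>|lebesgue. \<bar>u t\<bar> powr q * V_weight q w \<eta> t) \<le> A e powr q"
  proof (rule order_trans[OF _ UVl], unfold set_lebesgue_integral_def, rule integral_mono_AE')
    show "integrable lebesgue (\<lambda>t. indicat_real {a..b} t *\<^sub>R (U t powr q * V_weight q w \<eta> t))"
      using UVi by (simp add: set_integrable_def)
    show "AE t in lebesgue. indicat_real (open_ival \<eta>) t *\<^sub>R (\<bar>u t\<bar> powr q * V_weight q w \<eta> t)
        \<le> indicat_real {a..b} t *\<^sub>R (U t powr q * V_weight q w \<eta> t)"
      using Nae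
    proof eventually_elim
      case (elim t)
      show ?case
      proof (cases "t \<in> {a<..<b}")
        case True
        then have "\<bar>u t\<bar> powr q * V_weight q w \<eta> t \<le> U t powr q * V_weight q w \<eta> t"
          using N(3)[of t] elim uU[of t] q by (intro mult_right_mono powr_mono2) auto
        then show ?thesis using True sub by (auto simp: subset_iff)
      next
        case False
        with elim have "t \<notin> {a..b}" by auto
        then show ?thesis unfolding Vout[OF False] by simp
      qed
    qed
    show "AE t in lebesgue. 0 \<le> indicat_real {a..b} t *\<^sub>R (U t powr q * V_weight q w \<eta> t)"
      using Nae
    proof eventually_elim
      case (elim t)
      then show ?case using N(3)[of t] by (auto simp: indicator_def)
    qed
  qed
  \<comment> \<open>Nonnegativity allows the monotone power \<open>1 / q\<close> to be applied to
    the bound \<open>X\<close>.\<close>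
  have X0: "0 \<le> (LINT t:open_ival \<eta>|lebesgue. \<bar>u t\<bar> powr q * V_weight q w \<eta> t)"
    unfolding set_lebesgue_integral_def
  proof (rule integral_nonneg_AE)
    show "AE t in lebesgue. 0 \<le> indicat_real (open_ival \<eta>) t *\<^sub>R (\<bar>u t\<bar> powr q * V_weight q w \<eta> t)"
      using Nae
    proof eventually_elim
      case (elim t)
      show ?case
      proof (cases "t \<in> {a<..<b}")
        case True
        then show ?thesis using N(3)[of t] elim by simp
      next
        case False
        show ?thesis unfolding Vout[OF False] by simp
      qed
    qed
  qed
  have ea: "A e = integral {a..b} (\<lambda>t. v t * p t)"
    using Aeq[of e] ab by (auto simp: e_def)
  have Ae0: "0 \<le> A e" unfolding ea using p0 int[of a b] by (intro integral_nonneg) (auto simp: v_def)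
  have "(LINT t:open_ival \<eta>|lebesgue. \<bar>u t\<bar> powr q * V_weight q w \<eta> t) powr (1 / q) \<le> (A e powr q) powr (1 / q)"
    using X X0 q by (intro powr_mono2) auto
  also have "\<dots> = A e" using Ae0 q by (simp add: powr_powr)
  also have "\<dots> \<le> integral {a..b} (\<lambda>t. v t * w t)"
    unfolding ea
  proof (rule integral_le)
    show "(\<lambda>t. v t * w t) integrable_on {a..b}"
      using cv cw by (intro integrable_continuous_real continuous_intros)
    show "v t * p t \<le> v t * w t" if "t \<in> {a..b}" for t
      using p_le[of t] that sub by (intro mult_left_mono) (auto simp: v_def)
  qed (use int in auto)
  also have "\<dots> = (LINT t:{a..b}|lebesgue. v t * w t)"
    using cv cw by (intro set_lebesgue_integral_eq_integral(2)[symmetric] absolutely_integrable_continuous_real continuous_intros)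
  also have "\<dots> = (LINT t:open_ival \<eta>|lebesgue. \<bar>deriv u t\<bar> * w t)"
    unfolding set_lebesgue_integral_def
  proof (rule Bochner_Integration.integral_cong[OF refl])
    fix t
    show "indicat_real {a..b} t *\<^sub>R (v t * w t) = indicat_real (open_ival \<eta>) t *\<^sub>R (\<bar>deriv u t\<bar> * w t)"
    proof (cases "t \<in> {a..b}")
      case True
      with sub have "t \<in> open_ival \<eta>" by blast
      with True show ?thesis by (simp add: v_def)
    next
      case False
      then have "t \<in> open_ival \<eta> \<Longrightarrow> deriv u t = 0" using du0[of t] by auto
      with False show ?thesis by (auto simp: indicator_def)
    qed
  qed
  finally show "1 * (LINT t:open_ival \<eta>|lebesgue. \<bar>u t\<bar> powr q * V_weight q w \<eta> t) powr (1 / q)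
      \<le> (LINT t:open_ival \<eta>|lebesgue. \<bar>deriv u t\<bar> * w t)" by simp
qed

end

section \<open>Trapezoidal test functions\<close>

text \<open>A quadratic spline rising from 0 to 1 on \<open>{0..1}\<close>. Truncated squares have
  continuous derivatives, so it is C1, as a piecewise linear ramp would not be.\<close>

definition ramp :: "real \<Rightarrow> real" where
  "ramp x = 2 * (max 0 x)\<^sup>2 - 4 * (max 0 (x - 1/2))\<^sup>2 + 2 * (max 0 (x - 1))\<^sup>2"

text \<open>The derivative of \<open>ramp\<close>: a triangle over \<open>{0..1}\<close> of height 2
  and area 1.\<close>

definition tent :: "real \<Rightarrow> real" where
  "tent x = 4 * max 0 x - 8 * max 0 (x - 1/2) + 4 * max 0 (x - 1)"

text \<open>The only doubtful point is 0, where the difference quotient is \<open>max 0 h\<close>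
  and tends to 0.\<close>

lemma has_real_derivative_max_0_power2:
  "((\<lambda>x::real. (max 0 x)\<^sup>2) has_real_derivative 2 * max 0 x) (at x)"
proof (cases x "0 :: real" rule: linorder_cases)
  case less
  show ?thesis
    by (rule has_field_derivative_transform_within_open[where S = "{..<0}" and f = "\<lambda>_. 0"])
      (use less in auto)
next
  case greater
  show ?thesis
    by (rule has_field_derivative_transform_within_open[where S = "{0<..}" and f = "\<lambda>x. x\<^sup>2"])
      (use greater in \<open>auto intro!: derivative_eq_intros\<close>)
next
  case equal
  have "((\<lambda>h::real. max 0 h) \<longlongrightarrow> max 0 0) (at 0)" by (intro tendsto_intros)
  moreover have "(max 0 h)\<^sup>2 / h = max 0 h" for h :: real
    by (auto simp: max_def power2_eq_square)
  ultimately show ?thesis using equal by (simp add: DERIV_def)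
qed

lemma ramp_derivative: "(ramp has_real_derivative tent x) (at x)"
proof -
  note D = DERIV_chain2[OF has_real_derivative_max_0_power2]
  show ?thesis
    unfolding ramp_def[abs_def] tent_def
    by (rule derivative_eq_intros D refl | simp)+
qed

lemma tent_nonneg: "0 \<le> tent x"
  by (auto simp: tent_def max_def)

lemma tent_outside: "x \<le> 0 \<or> 1 \<le> x \<Longrightarrow> tent x = 0"
  by (auto simp: tent_def max_def)

lemma ramp_below: "x \<le> 0 \<Longrightarrow> ramp x = 0"
  by (simp add: ramp_def)

lemma ramp_above: "1 \<le> x \<Longrightarrow> ramp x = 1"
  by (simp add: ramp_def power2_eq_square algebra_simps)

lemma continuous_on_tent: "continuous_on S tent"
  unfolding tent_def by (intro continuous_intros)

lemma ramp_scaled_derivative: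
  assumes "d \<noteq> 0"
  shows "((\<lambda>t. ramp ((t - c) / d)) has_real_derivative tent ((t - c) / d) / d) (at t)"
proof -
  have "((\<lambda>t. (t - c) / d) has_real_derivative 1 / d) (at t)"
    by (rule derivative_eq_intros refl | use assms in simp)+
  from DERIV_chain2[OF ramp_derivative this] show ?thesis by simp
qed

lemma continuous_on_tent_scaled: "d \<noteq> 0 \<Longrightarrow> continuous_on S (\<lambda>t. tent ((t - c) / d) / d)"
  by (intro continuous_intros continuous_on_compose2[OF continuous_on_tent[of UNIV]]) auto

text \<open>A scaled tent is the derivative of a scaled ramp that rises by 1 over the interval, so
  it has unit mass for every \<open>d\<close> and acts as an approximate point mass.\<close>

lemma tent_scaled_integral:
  assumes "d > 0"
  shows "set_integrable lebesgue {c..c + d} (\<lambda>t. M * (tent ((t - c) / d) / d))"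
    "(LINT t:{c..c + d}|lebesgue. M * (tent ((t - c) / d) / d)) = M"
proof -
  show I: "set_integrable lebesgue {c..c + d} (\<lambda>t. M * (tent ((t - c) / d) / d))"
    using assms by (intro absolutely_integrable_continuous_real continuous_on_mult continuous_on_const continuous_on_tent_scaled) auto
  have "((\<lambda>t. tent ((t - c) / d) / d) has_integral ramp ((c + d - c) / d) - ramp ((c - c) / d)) {c..c + d}"
    using assms ramp_scaled_derivative[of d c]
    by (intro fundamental_theorem_of_calculus)
      (auto simp: has_real_derivative_iff_has_vector_derivative[symmetric] intro: has_field_derivative_at_within)
  then have "((\<lambda>t. tent ((t - c) / d) / d) has_integral 1) {c..c + d}"
    using assms by (simp add: ramp_below ramp_above)
  from has_integral_mult_right[OF this, of M]
  have "((\<lambda>t. M * (tent ((t - c) / d) / d)) has_integral M) {c..c + d}" by (simp only: mult_1_right)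
  then show "(LINT t:{c..c + d}|lebesgue. M * (tent ((t - c) / d) / d)) = M"
    unfolding set_lebesgue_integral_eq_integral(2)[OF I] by (rule integral_unique)
qed

text \<open>One ramp rises over \<open>{a - d..a}\<close> and the other is subtracted over
  \<open>{b..b + d}\<close>. The bounds on \<open>d\<close> keep both intervals inside
  \<open>open_ival \<eta>\<close>, which makes the support compact there.\<close>

lemma trapezoid_C1c:
  assumes d: "0 < d" "d < a" "a \<le> b" "b + d \<in> open_ival \<eta>"
  defines "u \<equiv> \<lambda>t. ramp ((t - (a - d)) / d) - ramp ((t - b) / d)"
  shows "u \<in> C1c \<eta>"
    "deriv u t = tent ((t - (a - d)) / d) / d - tent ((t - b) / d) / d"
    "t \<in> {a..b} \<Longrightarrow> u t = 1" "t \<notin> {a - d..b + d} \<Longrightarrow> u t = 0"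
    "continuous_on S u"
proof -
  have der: "(u has_real_derivative (tent ((t - (a - d)) / d) / d - tent ((t - b) / d) / d)) (at t)" for t
    unfolding u_def using d by (intro DERIV_diff ramp_scaled_derivative) auto
  then show "deriv u t = tent ((t - (a - d)) / d) / d - tent ((t - b) / d) / d"
    by (rule DERIV_imp_deriv)
  show "continuous_on S u"
    using der by (intro continuous_at_imp_continuous_on ballI DERIV_isCont) blast
  show "u t = 1" if "t \<in> {a..b}"
    using that d by (simp add: u_def ramp_below ramp_above field_simps)
  have out: "u t = 0" if "t \<notin> {a - d..b + d}" for t
    using that d by (cases "t < a - d") (auto simp: u_def ramp_below ramp_above field_simps)
  then show "t \<notin> {a - d..b + d} \<Longrightarrow> u t = 0" .
  have cl: "closure {t \<in> open_ival \<eta>. u t \<noteq> 0} \<subseteq> {a - d..b + d}"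
  proof (rule closure_minimal)
    show "{t \<in> open_ival \<eta>. u t \<noteq> 0} \<subseteq> {a - d..b + d}" using out by blast
  qed simp
  moreover have "{a - d..b + d} \<subseteq> open_ival \<eta>"
    using d by (intro open_ival_Icc_subset) auto
  moreover have "compact (closure {t \<in> open_ival \<eta>. u t \<noteq> 0})"
    using compact_Int_closed[OF compact_Icc[of "a - d" "b + d"] closed_closure[of "{t \<in> open_ival \<eta>. u t \<noteq> 0}"]]
    unfolding inf.absorb2[OF cl] .
  moreover have "u C1_differentiable_on open_ival \<eta>"
    unfolding C1_differentiable_on_def
    using der d by (intro exI[of _ "\<lambda>t. tent ((t - (a - d)) / d) / d - tent ((t - b) / d) / d"] conjI
        continuous_on_diff continuous_on_tent_scaled)
      (auto simp: has_real_derivative_iff_has_vector_derivative)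
  ultimately show "u \<in> C1c \<eta>" unfolding C1c_def by blast
qed

section \<open>A two-point bound for admissible constants\<close>

context monotone_minorant
begin

text \<open>A trapezoid with plateau \<open>{a..b}\<close> and steep sides is inserted. Its
  derivative concentrates with unit mass near each of \<open>a\<close> and \<open>b\<close>, so the
  left side is almost at most \<open>w a + w b\<close>, while the weighted integral is at least the
  integral of the weight over \<open>{a..b}\<close>.\<close>

lemma weighted_ineq_two_points:
  assumes q: "1 \<le> q" and C: "0 \<le> C" "weighted_ineq q \<eta> w C"
    and ab: "0 < a" "a \<le> b" "b \<in> open_ival \<eta>"
  shows "C * (\<sigma> * (p b powr q - p a powr q)) powr (1 / q) \<le> w a + w b"
proof (rule field_le_epsilon)
  fix e :: real assume e: "0 < e"
  have b: "0 < b" using ab by simp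
  have near: "\<exists>r>0. \<forall>s. \<bar>s - t\<bar> < r \<longrightarrow> w s < w t + e / 2" if "0 < t" for t
  proof -
    have "isCont w t" using w_continuous that by (simp add: continuous_on_eq_continuous_at)
    then have "\<forall>\<^sub>F s in nhds t. w s < w t + e / 2"
      using e by (intro order_tendstoD(2)[where y = "w t"]) (auto simp: isCont_def tendsto_nhds_iff)
    then show ?thesis by (auto simp: eventually_nhds_metric dist_real_def)
  qed
  obtain r1 where r1: "r1 > 0" "\<And>s. \<bar>s - a\<bar> < r1 \<Longrightarrow> w s < w a + e / 2" using near[OF ab(1)] by blast
  obtain r2 where r2: "r2 > 0" "\<And>s. \<bar>s - b\<bar> < r2 \<Longrightarrow> w s < w b + e / 2" using near[OF b] by blast
  obtain c where c: "b < c" "c \<in> open_ival \<eta>"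
  proof -
    have "ereal b < \<eta>" using ab by (simp add: open_ival_def)
    from ereal_dense2[OF this] obtain r where "ereal b < ereal r" "ereal r < \<eta>" by auto
    then show thesis using that[of r] ab by (auto simp: open_ival_def)
  qed
  \<comment> \<open>The width stays below both continuity radii of \<open>w\<close>, keeps
    \<open>a - d\<close> positive, and keeps \<open>b + d\<close> at most \<open>c\<close>, hence
    inside the domain.\<close>
  define d where "d = min (min (r1 / 2) (r2 / 2)) (min (a / 2) (c - b))"
  have d: "0 < d" "d < r1" "d < r2" "d < a" "d \<le> c - b"
    using r1(1) r2(1) ab(1) c(1) by (auto simp: d_def min_def)
  have bd: "b + d \<in> open_ival \<eta>"
    using open_ival_Icc_subset[OF ab(1) c(2)] d ab by auto
  have sub: "{a - d..b + d} \<subseteq> open_ival \<eta>" using d bd by (intro open_ival_Icc_subset) auto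
  define u where "u t = ramp ((t - (a - d)) / d) - ramp ((t - b) / d)" for t
  note u = trapezoid_C1c[OF d(1,4) ab(2) bd, folded u_def]
  define ka where "ka t = tent ((t - (a - d)) / d) / d" for t
  define kb where "kb t = tent ((t - b) / d) / d" for t
  have kpos: "0 \<le> ka t" "0 \<le> kb t" for t
    using d(1) tent_nonneg by (auto simp: ka_def kb_def)
  have ka0: "ka t = 0" if "t \<notin> {a - d..a}" for t
    using that d(1) unfolding ka_def by (subst tent_outside) (auto simp: field_simps)
  have kb0: "kb t = 0" if "t \<notin> {b..b + d}" for t
    using that d(1) unfolding kb_def by (subst tent_outside) (auto simp: field_simps)
  have wpos: "0 \<le> w t" if "t \<in> {a - d..b + d}" for t
    using p_nonneg[of t] p_le[of t] sub that by (auto simp: subset_iff)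
  \<comment> \<open>On the two side intervals \<open>w\<close> exceeds its value at \<open>a\<close>
    or \<open>b\<close> by at most \<open>e / 2\<close>, and each scaled tent has unit mass.\<close>
  have L: "(LINT t:open_ival \<eta>|lebesgue. \<bar>deriv u t\<bar> * w t) \<le> (w a + e / 2) + (w b + e / 2)"
  proof -
    note Ia = tent_scaled_integral[OF d(1), of "a - d" "w a + e / 2", unfolded diff_add_cancel, folded ka_def]
    note Ib = tent_scaled_integral[OF d(1), of b "w b + e / 2", folded kb_def]
    have "(LINT t:open_ival \<eta>|lebesgue. \<bar>deriv u t\<bar> * w t) \<le>
       (LINT t|lebesgue. indicat_real {a - d..a} t *\<^sub>R ((w a + e / 2) * ka t) + indicat_real {b..b + d} t *\<^sub>R ((w b + e / 2) * kb t))"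
      unfolding set_lebesgue_integral_def
    proof (rule integral_mono')
      show "integrable lebesgue (\<lambda>t. indicat_real {a - d..a} t *\<^sub>R ((w a + e / 2) * ka t) + indicat_real {b..b + d} t *\<^sub>R ((w b + e / 2) * kb t))"
        using Ia(1) Ib(1) unfolding set_integrable_def by (rule Bochner_Integration.integrable_add)
      fix t
      have A: "0 \<le> w a + e / 2" "0 \<le> w b + e / 2"
        using wpos[of a] wpos[of b] e ab d by auto
      show "0 \<le> indicat_real {a - d..a} t *\<^sub>R ((w a + e / 2) * ka t) + indicat_real {b..b + d} t *\<^sub>R ((w b + e / 2) * kb t)"
        using A kpos[of t] by (intro add_nonneg_nonneg) (auto simp: indicator_def)
      have "indicat_real (open_ival \<eta>) t *\<^sub>R (\<bar>deriv u t\<bar> * w t) \<le> ka t * w t + kb t * w t"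
      proof (cases "t \<in> {a - d..b + d}")
        case True
        have "\<bar>deriv u t\<bar> \<le> ka t + kb t"
          using kpos[of t] by (simp add: u(2) ka_def[symmetric] kb_def[symmetric])
        from mult_right_mono[OF this wpos[OF True]] True sub show ?thesis by (auto simp: algebra_simps)
      next
        case False
        then have "ka t = 0" "kb t = 0" using ka0[of t] kb0[of t] ab by auto
        then show ?thesis by (simp add: u(2) ka_def[symmetric] kb_def[symmetric])
      qed
      moreover have "ka t * w t \<le> indicat_real {a - d..a} t *\<^sub>R ((w a + e / 2) * ka t)"
      proof (cases "t \<in> {a - d..a}")
        case True
        then have "w t \<le> w a + e / 2" using r1(2)[of t] d by auto
        then show ?thesis using True kpos(1)[of t] by (simp add: mult.commute[of _ "ka t"] mult_left_mono)
      qed (use ka0 in simp)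
      moreover have "kb t * w t \<le> indicat_real {b..b + d} t *\<^sub>R ((w b + e / 2) * kb t)"
      proof (cases "t \<in> {b..b + d}")
        case True
        then have "w t \<le> w b + e / 2" using r2(2)[of t] d by auto
        then show ?thesis using True kpos(2)[of t] by (simp add: mult.commute[of _ "kb t"] mult_left_mono)
      qed (use kb0 in simp)
      ultimately show "indicat_real (open_ival \<eta>) t *\<^sub>R (\<bar>deriv u t\<bar> * w t)
          \<le> indicat_real {a - d..a} t *\<^sub>R ((w a + e / 2) * ka t) + indicat_real {b..b + d} t *\<^sub>R ((w b + e / 2) * kb t)"
        by linarith
    qed
    also have "\<dots> = (w a + e / 2) + (w b + e / 2)"
      using Bochner_Integration.integral_add[OF Ia(1)[unfolded set_integrable_def] Ib(1)[unfolded set_integrable_def]]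
        Ia(2) Ib(2) by (simp only: set_lebesgue_integral_def)
    finally show ?thesis .
  qed
  have ad: "0 < a - d" "a - d \<le> b + d" using d ab by auto
  obtain N where N: "negligible N"
    "\<And>t. t \<in> {a - d<..<b + d} - N \<Longrightarrow> 0 \<le> V_weight q w \<eta> t"
    and Vint: "V_weight q w \<eta> absolutely_integrable_on {a - d..b + d}"
    by (rule weight_integral[OF q ad bd]) blast
  obtain Vab: "V_weight q w \<eta> absolutely_integrable_on {a..b}"
    and Vab': "(V_weight q w \<eta> has_integral \<sigma> * (p b powr q - p a powr q)) {a..b}"
    by (rule weight_integral[OF q ab]) blast
  have Nae: "AE t in lebesgue. t \<notin> N \<union> {a - d, b + d}"
    by (rule AE_not_in) (use N(1) in \<open>simp add: negligible_iff_null_sets[symmetric]\<close>)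
  have uV: "(\<lambda>t. \<bar>u t\<bar> powr q * V_weight q w \<eta> t) absolutely_integrable_on {a - d..b + d}"
  proof (rule absolutely_integrable_bounded_measurable_product_real)
    have cu: "continuous_on {a - d..b + d} (\<lambda>t. \<bar>u t\<bar> powr q)"
      using q by (intro continuous_on_powr' continuous_intros u(5)) auto
    show "(\<lambda>t. \<bar>u t\<bar> powr q) \<in> borel_measurable (lebesgue_on {a - d..b + d})"
      by (intro continuous_imp_measurable_on_sets_lebesgue cu) auto
    show "bounded ((\<lambda>t. \<bar>u t\<bar> powr q) ` {a - d..b + d})"
      by (intro compact_imp_bounded compact_continuous_image cu compact_Icc)
  qed (use Vint in auto)
  have "\<sigma> * (p b powr q - p a powr q) = (LINT t:{a..b}|lebesgue. V_weight q w \<eta> t)"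
    using set_lebesgue_integral_eq_integral(2)[OF Vab] Vab' by (simp add: integral_unique)
  \<comment> \<open>The function \<open>u\<close> is 1 on \<open>{a..b}\<close>, and the weight is
    nonnegative almost everywhere on the two side intervals.\<close>
  also have "\<dots> \<le> (LINT t:{a - d..b + d}|lebesgue. \<bar>u t\<bar> powr q * V_weight q w \<eta> t)"
    unfolding set_lebesgue_integral_def
  proof (rule integral_mono_AE)
    show "integrable lebesgue (\<lambda>t. indicat_real {a..b} t *\<^sub>R V_weight q w \<eta> t)"
      using Vab by (simp add: set_integrable_def)
    show "integrable lebesgue (\<lambda>t. indicat_real {a - d..b + d} t *\<^sub>R (\<bar>u t\<bar> powr q * V_weight q w \<eta> t))"
      using uV by (simp add: set_integrable_def)
    show "AE t in lebesgue. indicat_real {a..b} t *\<^sub>R V_weight q w \<eta> t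
        \<le> indicat_real {a - d..b + d} t *\<^sub>R (\<bar>u t\<bar> powr q * V_weight q w \<eta> t)"
      using Nae
    proof eventually_elim
      case (elim t)
      then show ?case
        using N(2)[of t] u(3)[of t] d by (cases "t \<in> {a..b}") (auto simp: indicator_def)
    qed
  qed
  also have "\<dots> = (LINT t:open_ival \<eta>|lebesgue. \<bar>u t\<bar> powr q * V_weight q w \<eta> t)"
    unfolding set_lebesgue_integral_def
  proof (rule Bochner_Integration.integral_cong[OF refl])
    fix t
    show "indicat_real {a - d..b + d} t *\<^sub>R (\<bar>u t\<bar> powr q * V_weight q w \<eta> t)
        = indicat_real (open_ival \<eta>) t *\<^sub>R (\<bar>u t\<bar> powr q * V_weight q w \<eta> t)"
    proof (cases "t \<in> {a - d..b + d}")
      case True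
      with sub have "t \<in> open_ival \<eta>" by blast
      with True show ?thesis by simp
    next
      case False
      then show ?thesis unfolding u(4)[OF False] by simp
    qed
  qed
  finally have X: "\<sigma> * (p b powr q - p a powr q) \<le> (LINT t:open_ival \<eta>|lebesgue. \<bar>u t\<bar> powr q * V_weight q w \<eta> t)" .
  have "0 \<le> \<sigma> * (p b powr q - p a powr q)"
  proof -
    have "a \<in> open_ival \<eta>" using open_ival_Icc_subset[OF ab(1,3)] ab by auto
    then show ?thesis
      using p_mono[of a b] p_nonneg[of a] p_nonneg[of b] ab sigma q by (auto intro!: powr_mono2)
  qed
  then have "C * (\<sigma> * (p b powr q - p a powr q)) powr (1 / q)
      \<le> C * (LINT t:open_ival \<eta>|lebesgue. \<bar>u t\<bar> powr q * V_weight q w \<eta> t) powr (1 / q)"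
    using X C(1) q by (intro mult_left_mono powr_mono2) auto
  also have "\<dots> \<le> (LINT t:open_ival \<eta>|lebesgue. \<bar>deriv u t\<bar> * w t)"
    using C(2) u(1) by (auto simp: weighted_ineq_def)
  finally show "C * (\<sigma> * (p b powr q - p a powr q)) powr (1 / q) \<le> w a + w b + e"
    using L by linarith
qed

end

section \<open>The minorants of a weight\<close>

lemma W_space_pos: "w \<in> W_space a \<Longrightarrow> 0 < t \<Longrightarrow> 0 < w t"
  by (simp add: W_space_def)

lemma W_space_lipschitz: "w \<in> W_space c \<Longrightarrow> 0 < a \<Longrightarrow> \<exists>L. L-lipschitz_on {a..b} w"
proof -
  assume "w \<in> W_space c" "0 < a"
  moreover have "compact {a..b}" "0 < a \<Longrightarrow> {a..b} \<subseteq> {0<..}" by auto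
  ultimately show ?thesis unfolding W_space_def by blast
qed

lemma W_space_continuous:
  assumes "w \<in> W_space c"
  shows "continuous_on {0<..} w"
proof (rule continuous_at_imp_continuous_on, rule ballI)
  fix t :: real assume "t \<in> {0<..}"
  then have t: "0 < t" by simp
  obtain L where "L-lipschitz_on {t/2..2*t} w" using W_space_lipschitz[OF assms, of "t/2"] t by auto
  then have "continuous_on {t/2..2*t} w" by (rule lipschitz_on_continuous_on)
  then show "isCont w t" by (rule continuous_on_interior) (use t in auto)
qed

lemma W_space_0_tendsto: "w \<in> W_space 0 \<Longrightarrow> (w \<longlongrightarrow> 0) (at_right 0)"
  by (simp add: W_space_def zero_ereal_def lim_ereal)

lemma W_space_infinity_filterlim: "w \<in> W_space \<infinity> \<Longrightarrow> filterlim w at_top (at_right 0)"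
  by (simp add: W_space_def tendsto_PInfty_eq_at_top)

text \<open>Limits at 0 are unique. For \<open>w\<close> in \<open>W_space \<infinity>\<close> this
  ensures that the case distinction in \<open>V_weight\<close> selects
  \<open>\<psi>\<close>.\<close>

lemma W_space_disjoint:
  assumes "w \<in> W_space a" "w \<in> W_space b"
  shows "a = b"
proof (rule tendsto_unique[OF trivial_limit_at_right_real])
  show "((\<lambda>t. ereal (w t)) \<longlongrightarrow> a) (at_right 0)" "((\<lambda>t. ereal (w t)) \<longlongrightarrow> b) (at_right 0)"
    using assms by (simp_all add: W_space_def)
qed

lemma W_space_lower_bound:
  assumes "w \<in> W_space c" "0 < a"
  obtains m where "0 < m" "\<And>t. t \<in> {a..b} \<Longrightarrow> m \<le> w t"
proof (cases "a \<le> b")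
  case True
  have "continuous_on {a..b} w"
    by (rule continuous_on_subset[OF W_space_continuous[OF assms(1)]]) (use assms in auto)
  then obtain x where "x \<in> {a..b}" "\<forall>t\<in>{a..b}. w x \<le> w t"
    using continuous_attains_inf[of "{a..b}" w] True by auto
  then show thesis using that[of "w x"] W_space_pos[OF assms(1), of x] assms(2) by auto
qed (use that[of 1] in auto)

lemma phi_eq: "t \<in> open_ival \<eta> \<Longrightarrow> \<phi> w \<eta> t = (INF s\<in>{s. t \<le> s \<and> ereal s \<le> \<eta>}. w s)"
  by (simp add: \<phi>_def open_ival_def less_imp_le)

lemma psi_eq: "t \<in> open_ival \<eta> \<Longrightarrow> \<psi> w \<eta> t = (INF s\<in>{0<..t}. w s)"
  by (simp add: \<psi>_def open_ival_def less_imp_le)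

lemma phi_lower:
  assumes "w \<in> W_space c" "t \<in> open_ival \<eta>" "t \<le> s" "ereal s \<le> \<eta>"
  shows "\<phi> w \<eta> t \<le> w s"
  unfolding phi_eq[OF assms(2)]
  by (rule cINF_lower, rule bdd_belowI[of _ 0])
    (use assms W_space_pos[OF assms(1)] in \<open>auto simp: open_ival_def intro!: less_imp_le\<close>)

lemma phi_greatest:
  assumes "t \<in> open_ival \<eta>" "\<And>s. t \<le> s \<Longrightarrow> ereal s \<le> \<eta> \<Longrightarrow> m \<le> w s"
  shows "m \<le> \<phi> w \<eta> t"
  unfolding phi_eq[OF assms(1)]
  by (rule cINF_greatest) (use assms in \<open>auto simp: open_ival_def\<close>)

lemma psi_lower:
  assumes "w \<in> W_space c" "t \<in> open_ival \<eta>" "0 < s" "s \<le> t"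
  shows "\<psi> w \<eta> t \<le> w s"
  unfolding psi_eq[OF assms(2)]
  by (rule cINF_lower, rule bdd_belowI[of _ 0])
    (use assms W_space_pos[OF assms(1)] in \<open>auto intro!: less_imp_le\<close>)

lemma psi_greatest:
  assumes "t \<in> open_ival \<eta>" "\<And>s. 0 < s \<Longrightarrow> s \<le> t \<Longrightarrow> m \<le> w s"
  shows "m \<le> \<psi> w \<eta> t"
  unfolding psi_eq[OF assms(1)]
  by (rule cINF_greatest) (use assms in \<open>auto simp: open_ival_def\<close>)

lemma lipschitz_on_ordered:
  fixes f :: "real \<Rightarrow> real"
  assumes "0 \<le> L" "\<And>x y. x \<in> S \<Longrightarrow> y \<in> S \<Longrightarrow> x \<le> y \<Longrightarrow> \<bar>f x - f y\<bar> \<le> L * (y - x)"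
  shows "L-lipschitz_on S f"
proof (rule lipschitz_onI)
  show "dist (f x) (f y) \<le> L * dist x y" if "x \<in> S" "y \<in> S" for x y
    using assms(2)[of x y] assms(2)[of y x] that
    by (cases "x \<le> y") (auto simp: dist_real_def abs_minus_commute)
qed fact

text \<open>The clause with content is the Lipschitz bound: on \<open>{a..b}\<close> the minorant
  inherits the constant of \<open>w\<close>, although its infimum ranges beyond
  \<open>b\<close>.\<close>

lemma phi_monotone_minorant:
  assumes w: "w \<in> W_space 0" and \<eta>: "0 < \<eta>"
  shows "monotone_minorant w (\<phi> w \<eta>) \<eta> 1"
proof
  show "0 < \<eta>" by fact
  show "continuous_on {0<..} w" using w by (rule W_space_continuous)
  show "0 \<le> \<phi> w \<eta> t" if "t \<in> open_ival \<eta>" for t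
    using W_space_pos[OF w] that by (intro phi_greatest) (auto simp: open_ival_def intro!: less_imp_le)
  show "\<phi> w \<eta> t \<le> w t" if "t \<in> open_ival \<eta>" for t
    using that by (intro phi_lower[OF w]) (auto simp: open_ival_def)
  have mono: "\<phi> w \<eta> s \<le> \<phi> w \<eta> t" if "s \<in> open_ival \<eta>" "t \<in> open_ival \<eta>" "s \<le> t" for s t
    using that by (intro phi_greatest phi_lower[OF w]) auto
  then show "1 * \<phi> w \<eta> s \<le> 1 * \<phi> w \<eta> t" if "s \<in> open_ival \<eta>" "t \<in> open_ival \<eta>" "s \<le> t" for s t
    using that by simp
  show "\<exists>L. L-lipschitz_on {a..b} (\<phi> w \<eta>)" if ab: "0 < a" "b \<in> open_ival \<eta>" for a b
  proof -
    obtain L where L: "L-lipschitz_on {a..b} w" using W_space_lipschitz[OF w ab(1)] by blast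
    have L0: "0 \<le> L" using L by (rule lipschitz_on_nonneg)
    have "L-lipschitz_on {a..b} (\<phi> w \<eta>)"
    proof (rule lipschitz_on_ordered[OF L0])
      fix x y assume xy: "x \<in> {a..b}" "y \<in> {a..b}" "x \<le> y"
      have I: "x \<in> open_ival \<eta>" "y \<in> open_ival \<eta>" using open_ival_Icc_subset[OF ab] xy by auto
      \<comment> \<open>A point beyond \<open>y\<close> already competes in the infimum at
        \<open>y\<close>. A point \<open>s\<close> between \<open>x\<close> and \<open>y\<close>
        satisfies \<open>w s \<ge> w y - L * (y - s)\<close>, and
        \<open>w y \<ge> \<phi> w \<eta> y\<close>.\<close>
      have "\<phi> w \<eta> y - L * (y - x) \<le> \<phi> w \<eta> x"
      proof (rule phi_greatest[OF I(1)])
        fix s assume s: "x \<le> s" "ereal s \<le> \<eta>"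
        show "\<phi> w \<eta> y - L * (y - x) \<le> w s"
        proof (cases "y \<le> s")
          case True
          have "0 \<le> L * (y - x)" using L0 xy by simp
          then show ?thesis using phi_lower[OF w I(2) True s(2)] by linarith
        next
          case False
          have "\<bar>w y - w s\<bar> \<le> L * (y - s)"
            using lipschitz_onD[OF L, of y s] False s xy by (simp add: dist_real_def)
          moreover have "L * (y - s) \<le> L * (y - x)" using s L0 by (intro mult_left_mono) auto
          moreover have "\<phi> w \<eta> y \<le> w y" using I(2) by (intro phi_lower[OF w]) (auto simp: open_ival_def)
          ultimately show ?thesis by linarith
        qed
      qed
      then show "\<bar>\<phi> w \<eta> x - \<phi> w \<eta> y\<bar> \<le> L * (y - x)" using mono[OF I xy(3)] by linarith
    qed
    then show ?thesis ..
  qed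
  show "V_weight q w \<eta> t = 1 * deriv (\<lambda>s. \<phi> w \<eta> s powr q) t" for q t
    using w by (simp add: V_weight_def)
qed simp

text \<open>Mirror image of the increasing case: passing from \<open>{0<..x}\<close> to
  \<open>{0<..y}\<close> adds only points within \<open>y - x\<close> of \<open>x\<close>, where
  \<open>w\<close> is at least \<open>w x - L * (y - x)\<close>.\<close>

lemma psi_monotone_minorant:
  assumes w: "w \<in> W_space \<infinity>" and \<eta>: "0 < \<eta>"
  shows "monotone_minorant w (\<psi> w \<eta>) \<eta> (- 1)"
proof
  show "0 < \<eta>" by fact
  show "continuous_on {0<..} w" using w by (rule W_space_continuous)
  show "0 \<le> \<psi> w \<eta> t" if "t \<in> open_ival \<eta>" for t
    using W_space_pos[OF w] that by (intro psi_greatest) (auto intro!: less_imp_le)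
  show "\<psi> w \<eta> t \<le> w t" if "t \<in> open_ival \<eta>" for t
    using that by (intro psi_lower[OF w]) (auto simp: open_ival_def)
  have mono: "\<psi> w \<eta> t \<le> \<psi> w \<eta> s" if "s \<in> open_ival \<eta>" "t \<in> open_ival \<eta>" "s \<le> t" for s t
    using that by (intro psi_greatest psi_lower[OF w]) auto
  then show "- 1 * \<psi> w \<eta> s \<le> - 1 * \<psi> w \<eta> t" if "s \<in> open_ival \<eta>" "t \<in> open_ival \<eta>" "s \<le> t" for s t
    using that by simp
  show "\<exists>L. L-lipschitz_on {a..b} (\<psi> w \<eta>)" if ab: "0 < a" "b \<in> open_ival \<eta>" for a b
  proof -
    obtain L where L: "L-lipschitz_on {a..b} w" using W_space_lipschitz[OF w ab(1)] by blast
    have L0: "0 \<le> L" using L by (rule lipschitz_on_nonneg)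
    have "L-lipschitz_on {a..b} (\<psi> w \<eta>)"
    proof (rule lipschitz_on_ordered[OF L0])
      fix x y assume xy: "x \<in> {a..b}" "y \<in> {a..b}" "x \<le> y"
      have I: "x \<in> open_ival \<eta>" "y \<in> open_ival \<eta>" using open_ival_Icc_subset[OF ab] xy by auto
      have "\<psi> w \<eta> x - L * (y - x) \<le> \<psi> w \<eta> y"
      proof (rule psi_greatest[OF I(2)])
        fix s assume s: "0 < s" "s \<le> y"
        show "\<psi> w \<eta> x - L * (y - x) \<le> w s"
        proof (cases "s \<le> x")
          case True
          have "0 \<le> L * (y - x)" using L0 xy by simp
          then show ?thesis using psi_lower[OF w I(1) s(1) True] by linarith
        next
          case False
          have "\<bar>w x - w s\<bar> \<le> L * (s - x)"
            using lipschitz_onD[OF L, of x s] False s xy by (simp add: dist_real_def)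
          moreover have "L * (s - x) \<le> L * (y - x)" using s L0 by (intro mult_left_mono) auto
          moreover have "\<psi> w \<eta> x \<le> w x" using I(1) by (intro psi_lower[OF w]) (auto simp: open_ival_def)
          ultimately show ?thesis by linarith
        qed
      qed
      then show "\<bar>\<psi> w \<eta> x - \<psi> w \<eta> y\<bar> \<le> L * (y - x)" using mono[OF I xy(3)] by linarith
    qed
    then show ?thesis ..
  qed
  have "w \<notin> W_space 0" using W_space_disjoint[OF w, of 0] by auto
  then show "V_weight q w \<eta> t = - 1 * deriv (\<lambda>s. \<psi> w \<eta> s powr q) t" for q t
    by (simp add: V_weight_def)
qed simp

section \<open>Sharpness of the constant one\<close>

text \<open>For finite \<open>\<eta>\<close> the infimum runs over a compact interval, where the
  positive continuous \<open>w\<close> has a positive minimum. For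
  \<open>\<eta> = \<infinity>\<close> a zero at one point forces \<open>\<phi>\<close> to vanish on
  all of \<open>{0<..}\<close>, so the weight would be degenerate.\<close>

lemma phi_pos:
  assumes w: "w \<in> W_space 0" and nd: "\<eta> = \<infinity> \<longrightarrow> \<not> degenerate_weight q \<eta> w" and T: "T \<in> open_ival \<eta>"
  shows "0 < \<phi> w \<eta> T"
proof (cases \<eta>)
  case (real r)
  obtain m where "0 < m" "\<And>t. t \<in> {T..r} \<Longrightarrow> m \<le> w t"
    using W_space_lower_bound[OF w] T by (auto simp: open_ival_def)
  then have "m \<le> \<phi> w \<eta> T" using T real by (intro phi_greatest) auto
  then show ?thesis using \<open>0 < m\<close> by simp
next
  case PInf
  have ival: "open_ival \<eta> = {0<..}" using PInf by (auto simp: open_ival_def)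
  have T0: "0 < T" using T ival by simp
  show ?thesis
  proof (rule ccontr)
    assume "\<not> 0 < \<phi> w \<eta> T"
    then have TT: "\<phi> w \<eta> T \<le> 0" by simp
    have zero: "\<phi> w \<eta> t = 0" if t: "0 < t" for t
    proof (rule antisym)
      interpret monotone_minorant w "\<phi> w \<eta>" \<eta> 1 using phi_monotone_minorant[OF w] PInf by simp
      show "0 \<le> \<phi> w \<eta> t" using p_nonneg t ival by simp
      show "\<phi> w \<eta> t \<le> 0"
      proof (rule ccontr)
        assume pos: "\<not> \<phi> w \<eta> t \<le> 0"
        obtain m where m: "0 < m" "\<And>s. s \<in> {T..t} \<Longrightarrow> m \<le> w s"
          using W_space_lower_bound[OF w T0] by metis
        \<comment> \<open>Values of \<open>w\<close> on \<open>{T..t}\<close> are at least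
          \<open>m\<close> and later ones at least \<open>\<phi> w \<eta> t\<close>, so
          \<open>\<phi> w \<eta> T\<close> would be positive.\<close>
        have "min m (\<phi> w \<eta> t) \<le> \<phi> w \<eta> T"
        proof (rule phi_greatest[OF T])
          fix s assume s: "T \<le> s" "ereal s \<le> \<eta>"
          show "min m (\<phi> w \<eta> t) \<le> w s"
          proof (cases "s \<le> t")
            case False
            then show ?thesis using phi_lower[OF w, of t \<eta> s] t s ival by (simp add: min.coboundedI2)
          qed (use m(2)[of s] s in \<open>simp add: min.coboundedI1\<close>)
        qed
        then show False using TT pos m(1) by (auto simp: min_def split: if_splits)
      qed
    qed
    have "V_weight q w \<eta> t = 0" if t: "0 < t" for t
    proof -
      have "((\<lambda>s. \<phi> w \<eta> s powr q) has_real_derivative 0) (at t)"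
        by (rule has_field_derivative_transform_within_open[where S = "{0<..}" and f = "\<lambda>_. 0"])
          (use t zero in auto)
      then show ?thesis using w by (simp add: V_weight_def DERIV_imp_deriv)
    qed
    then have "degenerate_weight q \<eta> w" by (simp add: degenerate_weight_def ival)
    then show False using nd PInf by simp
  qed
qed (use T in \<open>auto simp: open_ival_def\<close>)

text \<open>If \<open>C > 1\<close>, positivity of the infimum yields a point \<open>b\<close>
  beyond \<open>T\<close> with \<open>w b < C * \<phi> w \<eta> T\<close>. Letting \<open>a\<close>
  tend to 0 in the two-point bound gives \<open>C * \<phi> w \<eta> b \<le> w b\<close>, which
  contradicts monotonicity of \<open>\<phi>\<close>.\<close>

lemma weighted_ineq_phi_le_1:
  assumes w: "w \<in> W_space 0" and \<eta>: "0 < \<eta>" and q: "1 \<le> q"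
    and nd: "\<eta> = \<infinity> \<longrightarrow> \<not> degenerate_weight q \<eta> w" and C: "weighted_ineq q \<eta> w C"
  shows "C \<le> 1"
proof (rule ccontr)
  assume "\<not> C \<le> 1"
  then have C1: "1 < C" by simp
  interpret monotone_minorant w "\<phi> w \<eta>" \<eta> 1 by (rule phi_monotone_minorant[OF w \<eta>])
  obtain T where T: "T \<in> open_ival \<eta>"
    using ereal_dense2[OF \<eta>] by (auto simp: open_ival_def zero_ereal_def)
  have pT: "0 < \<phi> w \<eta> T" by (rule phi_pos[OF w nd T])
  have "\<exists>s. T \<le> s \<and> ereal s \<le> \<eta> \<and> w s < C * \<phi> w \<eta> T"
  proof (rule ccontr)
    assume "\<nexists>s. T \<le> s \<and> ereal s \<le> \<eta> \<and> w s < C * \<phi> w \<eta> T"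
    then have "C * \<phi> w \<eta> T \<le> \<phi> w \<eta> T" by (intro phi_greatest[OF T]) (auto simp: not_less)
    then show False using C1 pT by simp
  qed
  then obtain s where s: "T \<le> s" "ereal s \<le> \<eta>" "w s < C * \<phi> w \<eta> T" by blast
  have T0: "0 < T" "ereal T < \<eta>" using T by (auto simp: open_ival_def)
  \<comment> \<open>For finite \<open>\<eta>\<close> the infimum includes the endpoint
    \<open>\<eta>\<close>, which lies outside the open interval; by continuity the strict bound
    survives slightly to its left.\<close>
  have "\<exists>b. T \<le> b \<and> ereal b < \<eta> \<and> w b < C * \<phi> w \<eta> T"
  proof (cases "ereal s < \<eta>")
    case False
    then have "ereal s = \<eta>" using s by simp
    then have Ts: "T < s" using T0 by auto
    have "isCont w s" using w_continuous Ts T0 by (simp add: continuous_on_eq_continuous_at)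
    then have "\<forall>\<^sub>F x in at_left s. w x < C * \<phi> w \<eta> T"
      using s(3) by (intro order_tendstoD(2)[where y = "w s"]) (auto simp: isCont_def filterlim_at_split)
    moreover have "\<forall>\<^sub>F x in at_left s. x \<in> {T<..<s}" using Ts by (rule eventually_at_left_real)
    ultimately have "\<forall>\<^sub>F x in at_left s. w x < C * \<phi> w \<eta> T \<and> x \<in> {T<..<s}" by eventually_elim simp
    then obtain x where "w x < C * \<phi> w \<eta> T" "x \<in> {T<..<s}"
      using eventually_happens'[OF trivial_limit_at_left_real] by blast
    then show ?thesis using \<open>ereal s = \<eta>\<close> by (intro exI[of _ x]) auto
  qed (use s in blast)
  then obtain b where b: "T \<le> b" "ereal b < \<eta>" "w b < C * \<phi> w \<eta> T" by blast
  have bI: "b \<in> open_ival \<eta>" using b T0 by (simp add: open_ival_def)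
  have pb: "\<phi> w \<eta> T \<le> \<phi> w \<eta> b" using p_mono[OF T bI b(1)] by simp
  have ev: "\<forall>\<^sub>F a in at_right 0. a \<in> {0<..<b}" using b T0 by (intro eventually_at_right_real) simp
  have aI: "a \<in> open_ival \<eta>" if "a \<in> {0<..<b}" for a
    using open_ival_Icc_subset[OF _ bI, of a] that by auto
  have w0: "(w \<longlongrightarrow> 0) (at_right 0)" using w by (rule W_space_0_tendsto)
  have p0: "(\<phi> w \<eta> \<longlongrightarrow> 0) (at_right 0)"
    by (rule tendsto_sandwich[OF _ _ tendsto_const w0])
      (use ev in \<open>eventually_elim, use aI p_nonneg p_le in auto\<close>)+
  have "((\<lambda>a. \<phi> w \<eta> a powr q) \<longlongrightarrow> 0 powr q) (at_right 0)"
  proof (rule tendsto_powr'[OF p0 tendsto_const])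
    show "(0::real) \<noteq> 0 \<or> 0 < q \<and> (\<forall>\<^sub>F a in at_right 0. 0 \<le> \<phi> w \<eta> a)"
      using q ev by (auto elim!: eventually_mono intro!: p_nonneg aI)
  qed
  from tendsto_mult[OF tendsto_const tendsto_diff[OF tendsto_const this]]
  have "((\<lambda>a. 1 * (\<phi> w \<eta> b powr q - \<phi> w \<eta> a powr q)) \<longlongrightarrow> 1 * (\<phi> w \<eta> b powr q - 0 powr q)) (at_right 0)" .
  \<comment> \<open>The outer base tends to \<open>\<phi> w \<eta> b powr q\<close>, which is
    positive, so the power \<open>1 / q\<close> is continuous at the limit.\<close>
  from tendsto_mult[OF tendsto_const tendsto_powr[OF this tendsto_const]]
  have "((\<lambda>a. C * (1 * (\<phi> w \<eta> b powr q - \<phi> w \<eta> a powr q)) powr (1 / q))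
      \<longlongrightarrow> C * (1 * (\<phi> w \<eta> b powr q - 0 powr q)) powr (1 / q)) (at_right 0)"
    using pT pb by simp
  moreover have "((\<lambda>a. w a + w b) \<longlongrightarrow> 0 + w b) (at_right 0)" by (intro tendsto_intros w0)
  moreover have "\<forall>\<^sub>F a in at_right 0. C * (1 * (\<phi> w \<eta> b powr q - \<phi> w \<eta> a powr q)) powr (1 / q) \<le> w a + w b"
    using ev
  proof eventually_elim
    case (elim a)
    then show ?case using C1 bI by (intro weighted_ineq_two_points[OF q _ C]) auto
  qed
  ultimately have "C * (1 * (\<phi> w \<eta> b powr q - 0 powr q)) powr (1 / q) \<le> 0 + w b"
    by (intro tendsto_le[OF trivial_limit_at_right_real])
  then have "C * \<phi> w \<eta> b \<le> w b" using pT pb q by (simp add: powr_powr)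
  moreover have "C * \<phi> w \<eta> T \<le> C * \<phi> w \<eta> b" using pb C1 by simp
  ultimately show False using b(3) by linarith
qed

text \<open>The roles of the endpoints are exchanged: \<open>a\<close> is a point of
  \<open>{0<..T}\<close> where \<open>w\<close> nearly equals its infimum, and \<open>b\<close>
  tends to infinity, where \<open>w\<close> and hence \<open>\<psi>\<close> vanish.\<close>

lemma weighted_ineq_psi_le_1:
  assumes w: "w \<in> W_space \<infinity>" "(w \<longlongrightarrow> 0) at_top" and q: "1 \<le> q"
    and C: "weighted_ineq q \<infinity> w C"
  shows "C \<le> 1"
proof (rule ccontr)
  assume "\<not> C \<le> 1"
  then have C1: "1 < C" by simp
  interpret monotone_minorant w "\<psi> w \<infinity>" \<infinity> "- 1" by (rule psi_monotone_minorant[OF w(1)]) simp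
  have ival: "open_ival \<infinity> = {0<..}" by (auto simp: open_ival_def)
  have "\<forall>\<^sub>F t in at_right 0. 1 \<le> w t"
    using W_space_infinity_filterlim[OF w(1)] by (simp add: filterlim_at_top)
  then obtain T where T: "0 < T" "\<And>t. 0 < t \<Longrightarrow> t < T \<Longrightarrow> 1 \<le> w t"
    unfolding eventually_at_right_field by blast
  have TI: "T \<in> open_ival \<infinity>" using T ival by simp
  \<comment> \<open>The blow-up of \<open>w\<close> at 0 keeps its values near 0 away from zero, so
    the infimum over the noncompact \<open>{0<..T}\<close> is still positive.\<close>
  have "min 1 (w T) \<le> \<psi> w \<infinity> T"
  proof (rule psi_greatest[OF TI])
    fix s assume "0 < s" "s \<le> T"
    then show "min 1 (w T) \<le> w s" using T(2)[of s] by (cases "s = T") auto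
  qed
  then have pT: "0 < \<psi> w \<infinity> T" using W_space_pos[OF w(1) T(1)] by (auto simp: min_def split: if_splits)
  have "\<exists>a. 0 < a \<and> a \<le> T \<and> w a < C * \<psi> w \<infinity> T"
  proof (rule ccontr)
    assume "\<nexists>a. 0 < a \<and> a \<le> T \<and> w a < C * \<psi> w \<infinity> T"
    then have "C * \<psi> w \<infinity> T \<le> \<psi> w \<infinity> T" by (intro psi_greatest[OF TI]) (auto simp: not_less)
    then show False using C1 pT by simp
  qed
  then obtain a where a: "0 < a" "a \<le> T" "w a < C * \<psi> w \<infinity> T" by blast
  have pa: "\<psi> w \<infinity> T \<le> \<psi> w \<infinity> a" using p_mono[of a T] a T ival by simp
  have ev: "\<forall>\<^sub>F b in at_top. a < b" by (rule eventually_gt_at_top)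
  have nonneg: "\<forall>\<^sub>F b in at_top. 0 \<le> \<psi> w \<infinity> b"
    using ev by eventually_elim (use a ival p_nonneg in auto)
  have p0: "(\<psi> w \<infinity> \<longlongrightarrow> 0) at_top"
    by (rule tendsto_sandwich[OF _ _ tendsto_const w(2)])
      (use ev in \<open>eventually_elim, use a ival p_nonneg p_le in auto\<close>)+
  have "((\<lambda>b. \<psi> w \<infinity> b powr q) \<longlongrightarrow> 0 powr q) at_top"
  proof (rule tendsto_powr'[OF p0 tendsto_const])
    show "(0::real) \<noteq> 0 \<or> 0 < q \<and> (\<forall>\<^sub>F b in at_top. 0 \<le> \<psi> w \<infinity> b)"
      using q nonneg by simp
  qed
  from tendsto_mult[OF tendsto_const tendsto_diff[OF this tendsto_const]]
  have "((\<lambda>b. - 1 * (\<psi> w \<infinity> b powr q - \<psi> w \<infinity> a powr q)) \<longlongrightarrow> - 1 * (0 powr q - \<psi> w \<infinity> a powr q)) at_top" .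
  from tendsto_mult[OF tendsto_const tendsto_powr[OF this tendsto_const]]
  have "((\<lambda>b. C * (- 1 * (\<psi> w \<infinity> b powr q - \<psi> w \<infinity> a powr q)) powr (1 / q))
      \<longlongrightarrow> C * (- 1 * (0 powr q - \<psi> w \<infinity> a powr q)) powr (1 / q)) at_top"
    using pT pa by simp
  moreover have "((\<lambda>b. w a + w b) \<longlongrightarrow> w a + 0) at_top" by (intro tendsto_intros w(2))
  moreover have "\<forall>\<^sub>F b in at_top. C * (- 1 * (\<psi> w \<infinity> b powr q - \<psi> w \<infinity> a powr q)) powr (1 / q) \<le> w a + w b"
    using ev
  proof eventually_elim
    case (elim b)
    then show ?case using C1 a ival by (intro weighted_ineq_two_points[OF q _ C]) auto
  qed
  ultimately have "C * (- 1 * (0 powr q - \<psi> w \<infinity> a powr q)) powr (1 / q) \<le> w a + 0"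
    by (intro tendsto_le[OF trivial_limit_at_top_linorder])
  then have "C * \<psi> w \<infinity> a \<le> w a" using pT pa q by (simp add: powr_powr)
  moreover have "C * \<psi> w \<infinity> T \<le> C * \<psi> w \<infinity> a" using pa C1 by simp
  ultimately show False using a(3) by linarith
qed

text \<open>For \<open>\<eta> = \<infinity>\<close> the increasing minorant may vanish identically;
  then the weight is 0, every \<open>C\<close> is admissible and the supremum is infinite. The
  nondegeneracy condition in the first case excludes this.\<close>

theorem theorem2p1:
  fixes q :: real and \<eta> :: ereal and w :: "real \<Rightarrow> real"
  assumes "1 \<le> q" and "0 < \<eta>" and "w \<in> V_space"
  shows "(\<exists>C\<ge>1. weighted_ineq q \<eta> w C)
    \<and> ((w \<in> W_space 0 \<and> (\<eta> = \<infinity> \<longrightarrow> \<not> degenerate_weight q \<eta> w))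
        \<or> (w \<in> W_space \<infinity> \<and> \<eta> = \<infinity> \<and> (w \<longlongrightarrow> 0) at_top)
       \<longrightarrow> best_constant q \<eta> w = 1)"
proof (intro conjI impI)
  have one: "weighted_ineq q \<eta> w 1"
    using assms(3) monotone_minorant.weighted_ineq_1[OF phi_monotone_minorant[OF _ assms(2)] assms(1)]
      monotone_minorant.weighted_ineq_1[OF psi_monotone_minorant[OF _ assms(2)] assms(1)]
    unfolding V_space_def by blast
  then show "\<exists>C\<ge>1. weighted_ineq q \<eta> w C" by blast
  assume H: "(w \<in> W_space 0 \<and> (\<eta> = \<infinity> \<longrightarrow> \<not> degenerate_weight q \<eta> w))
    \<or> (w \<in> W_space \<infinity> \<and> \<eta> = \<infinity> \<and> (w \<longlongrightarrow> 0) at_top)"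
  have "C \<le> 1" if "weighted_ineq q \<eta> w C" for C
    using H that weighted_ineq_phi_le_1[OF _ assms(2,1)] weighted_ineq_psi_le_1[OF _ _ assms(1)] by blast
  then show "best_constant q \<eta> w = 1"
    unfolding best_constant_def
    by (intro antisym SUP_least SUP_upper2[of 1]) (use one in auto)
qed

end
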